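(* There exist constants $C > 0$ and $\delta > 0$ such that the following holds. If $r, s \in \mathbb{N}$ with $1 \le s \le r - C\log r$, and $\varepsilon = (r-s)/r$, then $$R_{r,s}(k) \ge \exp\bigg( \frac{\delta k (r-s)^2}{r} \bigg)$$ for every integer $k \ge (C/\varepsilon)\log r$.
   Context: For positive integers $r > s \ge 1$ and $k$, the set-colouring Ramsey number $R_{r,s}(k)$ is the least $n \in \mathbb{N}$ such that every colouring $\chi \colon E(K_n) \to \binom{[r]}{s}$ (each edge of the complete graph $K_n$ is assigned a set of exactly $s$ colours from $[r] = \{1,\dots,r\}$) contains a monochromatic clique of size $k$, that is, a set $S \subset V(K_n)$ with $|S| = k$ and a colour $i \in [r]$ such that $i \in \chi(e)$ for every $e \in \binom{S}{2}$. *)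

theory Defs
  imports Complex_Main "HOL-Library.Ramsey"
begin

text \<open>
  \<open>K\<^sub>n\<close> has vertex set \<open>{..<n}\<close>; its edges are the two-element subsets \<open>[{..<n}]\<^bsup>2\<^esup>\<close>, in the
  notation \<open>[A]\<^bsup>k\<^esup>\<close> of \<^const>\<open>nsets\<close>.  Values of a colouring outside the edge set are
  irrelevant.
\<close>

definition set_colouring :: "nat \<Rightarrow> nat \<Rightarrow> nat \<Rightarrow> (nat set \<Rightarrow> nat set) \<Rightarrow> bool" where
  "set_colouring r s n \<chi> \<longleftrightarrow> \<chi> \<in> [{..<n}]\<^bsup>2\<^esup> \<rightarrow> [{1..r}]\<^bsup>s\<^esup>"

definition has_mono_clique :: "nat \<Rightarrow> nat \<Rightarrow> nat \<Rightarrow> (nat set \<Rightarrow> nat set) \<Rightarrow> bool" where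
  "has_mono_clique r k n \<chi> \<longleftrightarrow> (\<exists>S \<in> [{..<n}]\<^bsup>k\<^esup>. \<exists>i \<in> {1..r}. \<forall>e \<in> [S]\<^bsup>2\<^esup>. i \<in> \<chi> e)"

definition set_colouring_Ramsey :: "nat \<Rightarrow> nat \<Rightarrow> nat \<Rightarrow> nat" where
  "set_colouring_Ramsey r s k =
     (LEAST n. \<forall>\<chi>. set_colouring r s n \<chi> \<longrightarrow> has_mono_clique r k n \<chi>)"

text \<open>The minimum is over a nonempty set, so \<open>LEAST\<close> is meaningful: colour each edge by the
  smallest colour of its colour set and apply the multicolour Ramsey theorem.\<close>

lemma set_colouring_Ramsey_exists:
  assumes "1 \<le> s" "s \<le> r"
  shows "\<exists>n. \<forall>\<chi>. set_colouring r s n \<chi> \<longrightarrow> has_mono_clique r k n \<chi>"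
proof -
  obtain n :: nat where n: "partn_lst {..<n} (replicate r k) 2"
    using ramsey_full by blast
  have "has_mono_clique r k n \<chi>" if \<chi>: "set_colouring r s n \<chi>" for \<chi>
  proof -
    have mem: "Min (\<chi> e) \<in> \<chi> e \<and> Min (\<chi> e) \<in> {1..r}" if "e \<in> [{..<n}]\<^bsup>2\<^esup>" for e
    proof -
      have "\<chi> e \<in> [{1..r}]\<^bsup>s\<^esup>" using \<chi> that by (auto simp: set_colouring_def)
      then have c: "\<chi> e \<subseteq> {1..r}" "finite (\<chi> e)" "card (\<chi> e) = s"
        by (auto simp: nsets_def)
      then have "\<chi> e \<noteq> {}" using assms by auto
      then show ?thesis using c Min_in by blast
    qed
    define f where "f e = Min (\<chi> e) - 1" for e
    have "f \<in> [{..<n}]\<^bsup>2\<^esup> \<rightarrow> {..<length (replicate r k)}"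
      using mem by (fastforce simp: f_def)
    then obtain i where i: "i < r" "monochromatic {..<n} (replicate r k ! i) 2 f i"
      using n unfolding partn_lst_def by (metis length_replicate)
    then obtain S where S: "S \<in> [{..<n}]\<^bsup>k\<^esup>" "f ` [S]\<^bsup>2\<^esup> \<subseteq> {i}"
      by (auto simp: monochromatic_def)
    have "Suc i \<in> \<chi> e" if "e \<in> [S]\<^bsup>2\<^esup>" for e
    proof -
      have "e \<in> [{..<n}]\<^bsup>2\<^esup>" using that S(1) by (auto simp: nsets_def)
      then have "Min (\<chi> e) \<in> \<chi> e" "1 \<le> Min (\<chi> e)" using mem by auto
      moreover have "f e = i" using S(2) that by auto
      ultimately show ?thesis by (auto simp: f_def)
    qed
    then show ?thesis unfolding has_mono_clique_def
      using S(1) i(1) by (intro bexI[of _ S] bexI[of _ "Suc i"]) auto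
  qed
  then show ?thesis by blast
qed

end

theory Submission
  imports Defs
begin

text \<open>
  Let \<open>d = r - s\<close> and \<open>\<epsilon> = d / r\<close>.  Every colour \<open>i\<close> gets a uniformly random map \<open>\<phi>\<^sub>i\<close> from the
  \<open>n \<approx> exp (\<delta> \<epsilon> d k)\<close> vertices to \<open>M \<approx> exp (\<epsilon> k / 400)\<close> points and a random graph \<open>G\<^sub>i\<close> on these points with
  non-edge density about \<open>\<epsilon> / 4\<close>, conditioned on every set of \<open>k / 2\<close> points spanning many non-edges.
  An edge \<open>e\<close> is missed by colour \<open>i\<close> if \<open>\<phi>\<^sub>i\<close> does not map it to an edge of \<open>G\<^sub>i\<close>; on average this happens for
  about \<open>d / 4\<close> colours.  An edge missed by at most \<open>d\<close> colours is coloured by \<open>s\<close> of the other colours.  A bad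
  edge, missed by more than \<open>d\<close> colours, is coloured by \<open>s\<close> colours that map it injectively, which are always
  available.  Hence \<open>\<phi>\<^sub>i\<close> is injective on a clique of colour \<open>i\<close>, and the order \<open>\<epsilon> k\<^sup>2\<close> non-edges of \<open>G\<^sub>i\<close> inside
  the image of the clique all come from bad edges.  Given \<open>k\<close> vertices and \<open>b\<close> edges of bounded degree between
  them, \<open>b\<close> of order \<open>\<epsilon> k\<^sup>2\<close>, all these edges are bad with probability at most \<open>exp (- c d b)\<close> by an exponential
  moment bound, the colours being independent.  This beats the union bound over the choices of the vertices
  and edges.
\<close>

subsection \<open>Exponential moments over random maps and graphs\<close>

lemma sum_PiE_insert:
  assumes "v \<notin> A" "finite A" "finite B"
  shows "(\<Sum>g\<in>insert v A \<rightarrow>\<^sub>E B. F g) = (\<Sum>g\<in>A \<rightarrow>\<^sub>E B. \<Sum>y\<in>B. F (g(v := y)))"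
proof -
  have "(\<Sum>g\<in>insert v A \<rightarrow>\<^sub>E B. F g) = (\<Sum>(y, g)\<in>B \<times> (A \<rightarrow>\<^sub>E B). F (g(v := y)))"
    unfolding PiE_insert_eq
    by (subst sum.reindex) (use assms inj_combinator[of v A "\<lambda>_. B"] in \<open>auto simp: case_prod_unfold\<close>)
  also have "\<dots> = (\<Sum>g\<in>A \<rightarrow>\<^sub>E B. \<Sum>y\<in>B. F (g(v := y)))"
    by (subst sum.cartesian_product[symmetric]) (rule sum.swap)
  finally show ?thesis .
qed

text \<open>The values of a uniform \<open>g\<close> are independent and each vanishes with
  probability \<open>1 / q\<close>, so the moment generating function of the number of zeros on
  \<open>F\<close> factors over the edges. It serves with \<open>c = 1/2\<close> for a lower tail
  and with \<open>c >= 1\<close> for an upper tail.\<close>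

lemma sum_PiE_power_card_zeros:
  fixes c :: real
  assumes "finite E" "F \<subseteq> E" "q \<ge> 1"
  shows "(\<Sum>g\<in>E \<rightarrow>\<^sub>E {..<q}. c ^ card {e\<in>F. g e = 0})
    = real q ^ card E * (1 + (c - 1) / real q) ^ card F"
proof -
  have fin: "finite F" using assms finite_subset by blast
  have "(\<Sum>g\<in>E \<rightarrow>\<^sub>E {..<q}. c ^ card {e\<in>F. g e = 0})
    = (\<Sum>g\<in>E \<rightarrow>\<^sub>E {..<q}. \<Prod>e\<in>E. if e \<in> F \<and> g e = 0 then c else 1)"
  proof (rule sum.cong)
    fix g
    have "{e\<in>E. e \<in> F \<and> g e = 0} = {e\<in>F. g e = 0}" using assms by auto
    then show "c ^ card {e\<in>F. g e = 0} = (\<Prod>e\<in>E. if e \<in> F \<and> g e = 0 then c else 1)"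
      using assms(1) by (simp flip: prod.inter_filter)
  qed simp
  also have "\<dots> = (\<Prod>e\<in>E. \<Sum>y<q. if e \<in> F \<and> y = 0 then c else 1)"
    using assms by (subst prod_sum_PiE) auto
  also have "\<dots> = (\<Prod>e\<in>E. real q * (if e \<in> F then 1 + (c - 1) / real q else 1))"
  proof (rule prod.cong)
    fix e
    obtain q' where "q = Suc q'" using assms(3) by (cases q) auto
    then have "(\<Sum>y<q. if y = 0 then c else 1) = c + (real q - 1)"
      by (simp add: sum.lessThan_Suc_shift del: sum.lessThan_Suc)
    moreover have "real q * (1 + (c - 1) / real q) = c + (real q - 1)"
      using assms(3) by (simp add: field_simps)
    ultimately show "(\<Sum>y<q. if e \<in> F \<and> y = 0 then c else 1)
      = real q * (if e \<in> F then 1 + (c - 1) / real q else 1)"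
      by auto
  qed simp
  also have "\<dots> = real q ^ card E * (1 + (c - 1) / real q) ^ card F"
  proof -
    have "{e \<in> E. e \<in> F} = F" using assms by auto
    then show ?thesis using assms(1) by (simp add: prod.distrib flip: prod.inter_filter)
  qed
  finally show ?thesis .
qed

text \<open>Reveal the images one vertex at a time. The exponent counts the vertices of
  \<open>S\<close> landing on a point that is already occupied by \<open>S\<close>. At most
  \<open>k\<close> of the \<open>M\<close> points are occupied, so each vertex of \<open>S\<close>
  contributes a factor of at most \<open>1 + k z / M\<close>.\<close>

lemma sum_PiE_power_collisions:
  fixes z :: real
  assumes "finite A" "card (A \<inter> S) \<le> k" "M \<ge> 1" "z \<ge> 1"
  shows "(\<Sum>\<phi>\<in>A \<rightarrow>\<^sub>E {..<M}. z ^ (card (A \<inter> S) - card (\<phi> ` (A \<inter> S))))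
    \<le> real M ^ card A * (1 + real k * z / real M) ^ card (A \<inter> S)"
  using assms(1,2)
proof (induction A rule: finite_induct)
  case empty
  then show ?case by simp
next
  case (insert v A)
  let ?w = "\<lambda>\<phi>. z ^ (card (A \<inter> S) - card (\<phi> ` (A \<inter> S)))"
  have "card (A \<inter> S) \<le> card (insert v A \<inter> S)"
    using insert.hyps by (intro card_mono) auto
  then have le: "card (A \<inter> S) \<le> k" using insert.prems by linarith
  note IH = insert.IH[OF le]
  have img: "(\<phi>(v := y)) ` (A \<inter> S) = \<phi> ` (A \<inter> S)" for \<phi> :: "'a \<Rightarrow> nat" and y
    using insert.hyps by auto
  show ?case
  proof (cases "v \<in> S")
    case False
    then have e: "insert v A \<inter> S = A \<inter> S" by auto
    have "(\<Sum>\<phi>\<in>insert v A \<rightarrow>\<^sub>E {..<M}. z ^ (card (insert v A \<inter> S) - card (\<phi> ` (insert v A \<inter> S))))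
      = real M * (\<Sum>\<phi>\<in>A \<rightarrow>\<^sub>E {..<M}. ?w \<phi>)"
      unfolding e sum_PiE_insert[OF insert.hyps(2,1) finite_lessThan] img
      by (simp add: sum_distrib_left)
    also have "\<dots> \<le> real M * (real M ^ card A * (1 + real k * z / real M) ^ card (A \<inter> S))"
      using IH by (rule mult_left_mono) simp
    finally show ?thesis unfolding e using insert.hyps by (simp add: mult.assoc)
  next
    case True
    then have ins: "insert v A \<inter> S = insert v (A \<inter> S)" and c: "card (insert v A \<inter> S) = Suc (card (A \<inter> S))"
      using insert.hyps by auto
    have "(\<Sum>y<M. z ^ (card (insert v A \<inter> S) - card ((\<phi>(v := y)) ` (insert v A \<inter> S))))
      \<le> ?w \<phi> * (real M + real k * z)" for \<phi> :: "'a \<Rightarrow> nat"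
    proof -
      let ?I = "\<phi> ` (A \<inter> S)"
      have fI: "finite ?I" and cI: "card ?I \<le> card (A \<inter> S)"
        using insert.hyps by (auto intro: card_image_le)
      \<comment> \<open>A hit raises the exponent by one. Relaxing its factor \<open>z\<close> to
        \<open>1 + z\<close> reduces the sum over \<open>y\<close> to counting the hits.\<close>
      have "z ^ (card (insert v A \<inter> S) - card ((\<phi>(v := y)) ` (insert v A \<inter> S)))
        \<le> ?w \<phi> * (1 + (if y \<in> ?I then z else 0))" for y
      proof -
        have i: "(\<phi>(v := y)) ` (insert v A \<inter> S) = insert y ?I"
          unfolding ins using img[of \<phi> y] by auto
        have "0 \<le> ?w \<phi>" using assms by simp
        then show ?thesis
          unfolding i c using fI cI
          by (cases "y \<in> ?I") (auto simp: insert_absorb Suc_diff_le distrib_left)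
      qed
      then have "(\<Sum>y<M. z ^ (card (insert v A \<inter> S) - card ((\<phi>(v := y)) ` (insert v A \<inter> S))))
        \<le> (\<Sum>y<M. ?w \<phi> * (1 + (if y \<in> ?I then z else 0)))" by (rule sum_mono)
      also have "\<dots> = ?w \<phi> * (real M + z * card {y\<in>{..<M}. y \<in> ?I})"
        by (simp add: sum.distrib flip: sum_distrib_left sum.inter_filter)
      also have "\<dots> \<le> ?w \<phi> * (real M + real k * z)"
      proof -
        have "card {y\<in>{..<M}. y \<in> ?I} \<le> card ?I" using fI by (intro card_mono) auto
        then have "real (card {y\<in>{..<M}. y \<in> ?I}) \<le> real k" using cI le by linarith
        then show ?thesis
          using assms by (intro mult_left_mono add_left_mono) (auto simp: mult.commute)
      qed
      finally show ?thesis .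
    qed
    then have "(\<Sum>\<phi>\<in>insert v A \<rightarrow>\<^sub>E {..<M}. z ^ (card (insert v A \<inter> S) - card (\<phi> ` (insert v A \<inter> S))))
      \<le> (\<Sum>\<phi>\<in>A \<rightarrow>\<^sub>E {..<M}. ?w \<phi> * (real M + real k * z))"
      using insert.hyps by (subst sum_PiE_insert) (auto intro: sum_mono)
    also have "\<dots> = (\<Sum>\<phi>\<in>A \<rightarrow>\<^sub>E {..<M}. ?w \<phi>) * (real M + real k * z)"
      by (simp add: sum_distrib_right)
    also have "\<dots> \<le> (real M ^ card A * (1 + real k * z / real M) ^ card (A \<inter> S)) * (real M + real k * z)"
      using IH assms by (intro mult_right_mono) auto
    also have "\<dots> = real M ^ card (insert v A) * (1 + real k * z / real M) ^ card (insert v A \<inter> S)"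
    proof -
      have "real M + real k * z = real M * (1 + real k * z / real M)"
        using assms by (simp add: field_simps)
      then show ?thesis using insert.hyps c by simp
    qed
    finally show ?thesis .
  qed
qed

section \<open>Subgraphs of bounded degree\<close>

text \<open>
  In a largest subgraph of degree at most \<open>D\<close>, either many vertices have degree \<open>D\<close>, or all edges of
  \<open>H\<close> between the remaining vertices belong to it.
\<close>

lemma obtain_bounded_degree_subset:
  assumes "finite U" "H \<subseteq> [U]\<^bsup>2\<^esup>"
    and dense: "\<And>W. W \<subseteq> U \<Longrightarrow> card W = h \<Longrightarrow> b \<le> card (H \<inter> [W]\<^bsup>2\<^esup>)"
    and "2 * b \<le> D * (card U - h + 1)" "h \<le> card U"
  obtains B where "B \<subseteq> H" "card B = b" "\<And>v. card {e\<in>B. v \<in> e} \<le> D"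
proof -
  have finH: "finite H" using assms(1,2) finite_imp_finite_nsets finite_subset by blast
  let ?P = "\<lambda>B. B \<subseteq> H \<and> (\<forall>v. card {e\<in>B. v \<in> e} \<le> D)"
  have "?P {}" by simp
  moreover have "\<forall>B. ?P B \<longrightarrow> card B < Suc (card H)"
    using finH by (auto simp: less_Suc_eq_le card_mono)
  ultimately obtain B where B: "?P B" and max: "\<And>B'. ?P B' \<Longrightarrow> card B' \<le> card B"
    using ex_has_greatest_nat[of ?P "{}" card "Suc (card H)"] by blast
  have finB: "finite B" using B finH finite_subset by blast
  define S where "S = {v\<in>U. card {e\<in>B. v \<in> e} = D}"
  have finS: "finite S" using assms by (simp add: S_def)
  have "b \<le> card B"
  proof (cases "card S \<le> card U - h")
    case True
    have "h \<le> card (U - S)" using True assms finS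
      by (subst card_Diff_subset) (auto simp: S_def)
    then obtain W where W: "W \<subseteq> U - S" "card W = h"
      by (meson obtain_subset_with_card_n)
    \<comment> \<open>By maximality of \<open>B\<close>: a further edge of \<open>H\<close> inside
      \<open>W\<close> could be added, as both its ends still have degree below
      \<open>D\<close>.\<close>
    have "H \<inter> [W]\<^bsup>2\<^esup> \<subseteq> B"
    proof
      fix e assume e: "e \<in> H \<inter> [W]\<^bsup>2\<^esup>"
      show "e \<in> B"
      proof (rule ccontr)
        assume ne: "e \<notin> B"
        have "card {e'\<in>insert e B. v \<in> e'} \<le> D" for v
        proof (cases "v \<in> e")
          case True
          then have "v \<in> U - S" using e W by (auto simp: nsets_def)
          then have "card {e\<in>B. v \<in> e} < D" using B by (auto simp: S_def less_le)
          moreover have "{e'\<in>insert e B. v \<in> e'} = insert e {e\<in>B. v \<in> e}" using True by auto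
          ultimately show ?thesis using finB by (simp add: card_insert_if)
        next
          case False
          then have "{e'\<in>insert e B. v \<in> e'} = {e\<in>B. v \<in> e}" by auto
          then show ?thesis using B by simp
        qed
        then have "?P (insert e B)" using e B by auto
        from max[OF this] show False using finB ne by simp
      qed
    qed
    then have "card (H \<inter> [W]\<^bsup>2\<^esup>) \<le> card B" using finB by (rule card_mono[rotated])
    moreover have "b \<le> card (H \<inter> [W]\<^bsup>2\<^esup>)" using W by (intro dense) auto
    ultimately show ?thesis by linarith
  next
    case False
    \<comment> \<open>Double counting: there are at least \<open>card U - h + 1\<close> vertices of
      degree \<open>D\<close>, and an edge of \<open>B\<close> contains at most two of them.\<close>
    have "D * card S = (\<Sum>v\<in>S. card {e\<in>B. v \<in> e})"
      by (simp add: S_def)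
    also have "\<dots> = (\<Sum>v\<in>S. \<Sum>e\<in>B. if v \<in> e then 1 else 0)"
      using finB by (simp flip: sum.inter_filter)
    also have "\<dots> = (\<Sum>e\<in>B. \<Sum>v\<in>S. if v \<in> e then 1 else 0)" by (rule sum.swap)
    also have "\<dots> = (\<Sum>e\<in>B. card {v\<in>S. v \<in> e})"
      using finS by (simp flip: sum.inter_filter)
    also have "\<dots> \<le> (\<Sum>e\<in>B. 2)"
    proof (rule sum_mono)
      fix e assume "e \<in> B"
      then have e: "finite e" "card e = 2" using B assms(2) by (auto simp: nsets_def)
      have "card {v\<in>S. v \<in> e} \<le> card e" using e by (intro card_mono) auto
      then show "card {v\<in>S. v \<in> e} \<le> 2" using e by simp
    qed
    finally have "D * card S \<le> 2 * card B" by (simp add: mult.commute)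
    moreover have "D * (card U - h + 1) \<le> D * card S" using False by (intro mult_left_mono) auto
    ultimately show ?thesis using assms by linarith
  qed
  \<comment> \<open>Trimmed to exactly \<open>b\<close> edges, the size over which the union bound
    will run.\<close>
  then obtain B' where B': "B' \<subseteq> B" "card B' = b" by (meson obtain_subset_with_card_n)
  have "card {e\<in>B'. v \<in> e} \<le> D" for v
  proof -
    have "card {e\<in>B'. v \<in> e} \<le> card {e\<in>B. v \<in> e}" using B' finB by (intro card_mono) auto
    then show ?thesis using B le_trans by blast
  qed
  then show ?thesis using that B' B by blast
qed

section \<open>One colour: exponential moments of missed edges\<close>

text \<open>
  A pair \<open>(\<phi>, g)\<close> is the data of one colour.  The function \<open>g\<close>, with values in \<open>{..<q}\<close>, encodes the graph
  in which \<open>f\<close> is a non-edge iff \<open>g f = 0\<close>; a uniformly random \<open>g\<close> has non-edge density \<open>1 / q\<close>.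
\<close>

definition missed :: "(nat \<Rightarrow> nat) \<times> (nat set \<Rightarrow> nat) \<Rightarrow> nat set \<Rightarrow> bool" where
  "missed w e \<longleftrightarrow> card (fst w ` e) \<noteq> 2 \<or> snd w (fst w ` e) = 0"

definition dense_nonedges :: "nat \<Rightarrow> nat \<Rightarrow> nat \<Rightarrow> nat \<Rightarrow> (nat set \<Rightarrow> nat) set" where
  "dense_nonedges M q h b = {g \<in> [{..<M}]\<^bsup>2\<^esup> \<rightarrow>\<^sub>E {..<q}.
     \<forall>W \<in> [{..<M}]\<^bsup>h\<^esup>. b \<le> card {e \<in> [W]\<^bsup>2\<^esup>. g e = 0}}"

text \<open>A Chernoff lower tail for the non-edges inside one \<open>W\<close>, then a union bound
  over at most \<open>M ^ h\<close> sets. Probability one half suffices: conditioning on such an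
  event at most doubles the average of a nonnegative weight.\<close>

lemma card_dense_nonedges:
  assumes "q \<ge> 1"
    and small: "2 * (real M ^ h * 2 ^ b * exp (- real (h choose 2) / (2 * real q))) \<le> 1"
  shows "card ([{..<M}]\<^bsup>2\<^esup> \<rightarrow>\<^sub>E {..<q}) \<le> 2 * card (dense_nonedges M q h b)"
proof -
  let ?E = "[{..<M}]\<^bsup>2\<^esup>"
  let ?A = "?E \<rightarrow>\<^sub>E {..<q}"
  let ?Bad = "\<lambda>W. {g\<in>?A. card {e \<in> [W]\<^bsup>2\<^esup>. g e = 0} < b}"
  have finE: "finite ?E" by (simp add: finite_imp_finite_nsets)
  have finA: "finite ?A" using finE by (auto intro: finite_PiE)
  have cA: "real (card ?A) = real q ^ card ?E" using finE by (simp add: card_PiE)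
  have bad: "real (card (?Bad W)) \<le> 2 ^ b * exp (- real (h choose 2) / (2 * real q)) * real (card ?A)"
    if W: "W \<in> [{..<M}]\<^bsup>h\<^esup>" for W
  proof -
    have sub: "[W]\<^bsup>2\<^esup> \<subseteq> ?E" using W by (auto simp: nsets_def)
    have "card W = h" using W by (simp add: nsets_def)
    then have cW: "card ([W]\<^bsup>2\<^esup>) = h choose 2" by simp
    have "real (card (?Bad W)) = (\<Sum>g\<in>?Bad W. 1)" by simp
    \<comment> \<open>Markov's inequality: the weight is at least 1 whenever \<open>W\<close> has
      fewer than \<open>b\<close> non-edges.\<close>
    also have "\<dots> \<le> (\<Sum>g\<in>?Bad W. 2 ^ b * (1/2) ^ card {e \<in> [W]\<^bsup>2\<^esup>. g e = 0})"
    proof (rule sum_mono)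
      fix g assume "g \<in> ?Bad W"
      then have "(2::real) ^ card {e \<in> [W]\<^bsup>2\<^esup>. g e = 0} \<le> 2 ^ b" by (intro power_increasing) auto
      then show "(1::real) \<le> 2 ^ b * (1/2) ^ card {e \<in> [W]\<^bsup>2\<^esup>. g e = 0}"
        by (simp add: power_divide)
    qed
    also have "\<dots> \<le> (\<Sum>g\<in>?A. 2 ^ b * (1/2) ^ card {e \<in> [W]\<^bsup>2\<^esup>. g e = 0})"
      using finA by (intro sum_mono2) auto
    also have "\<dots> = 2 ^ b * (real q ^ card ?E * (1 + (1/2 - 1) / real q) ^ (h choose 2))"
      using sum_PiE_power_card_zeros[OF finE sub \<open>q \<ge> 1\<close>, of "1/2"] cW
      by (simp flip: sum_distrib_left)
    also have "\<dots> \<le> 2 ^ b * (real q ^ card ?E * exp (- 1 / (2 * real q)) ^ (h choose 2))"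
    proof (intro mult_left_mono power_mono)
      show "1 + (1/2 - 1) / real q \<le> exp (- 1 / (2 * real q))"
        using exp_ge_add_one_self[of "- 1 / (2 * real q)"] by simp
      show "0 \<le> 1 + (1/2 - 1) / real q" using assms(1) by (simp add: field_simps)
    qed auto
    also have "exp (- 1 / (2 * real q)) ^ (h choose 2) = exp (- real (h choose 2) / (2 * real q))"
      by (simp flip: exp_of_nat_mult)
    finally show ?thesis by (simp add: cA mult_ac)
  qed
  let ?U = "\<Union>W\<in>[{..<M}]\<^bsup>h\<^esup>. ?Bad W"
  have "real (card ?U) \<le> (\<Sum>W\<in>[{..<M}]\<^bsup>h\<^esup>. real (card (?Bad W)))"
    using card_UN_le[of "[{..<M}]\<^bsup>h\<^esup>" ?Bad] by (simp add: finite_imp_finite_nsets flip: of_nat_sum)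
  also have "\<dots> \<le> (\<Sum>W\<in>[{..<M}]\<^bsup>h\<^esup>. 2 ^ b * exp (- real (h choose 2) / (2 * real q)) * real (card ?A))"
    by (rule sum_mono) (rule bad)
  also have "\<dots> = real (M choose h) * (2 ^ b * exp (- real (h choose 2) / (2 * real q)) * real (card ?A))"
    by simp
  also have "\<dots> \<le> real M ^ h * (2 ^ b * exp (- real (h choose 2) / (2 * real q)) * real (card ?A))"
  proof -
    have "M choose h \<le> M ^ h" by (cases "h \<le> M") (auto simp: binomial_le_pow binomial_eq_0)
    then have "real (M choose h) \<le> real M ^ h" by (metis of_nat_le_iff of_nat_power)
    then show ?thesis by (rule mult_right_mono) simp
  qed
  finally have U: "2 * real (card ?U) \<le> real (card ?A)"
    using mult_right_mono[OF small, of "real (card ?A)"] by (simp add: mult_ac)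
  have "?A \<subseteq> dense_nonedges M q h b \<union> ?U" by (auto simp: dense_nonedges_def not_le)
  then have "card ?A \<le> card (dense_nonedges M q h b \<union> ?U)"
    using finA by (intro card_mono) (auto simp: dense_nonedges_def finite_imp_finite_nsets)
  also have "\<dots> \<le> card (dense_nonedges M q h b) + card ?U" by (rule card_Un_le)
  finally show ?thesis using U by linarith
qed

text \<open>
  The exponent counts the vertices outside a set \<open>R\<close> of representatives of the fibres of \<open>\<phi>\<close>.  Each
  of them lies on at most \<open>D\<close> edges of \<open>B\<close>, while the edges within \<open>R\<close> have distinct images and are
  therefore missed independently.
\<close>

lemma sum_power_missed_fixed_map:
  fixes c :: real
  assumes "finite S" "B \<subseteq> [S]\<^bsup>2\<^esup>" and deg: "\<And>v. card {e\<in>B. v \<in> e} \<le> D"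
    and "\<phi> ` S \<subseteq> {..<M}" "q \<ge> 1" "c \<ge> 1"
  shows "(\<Sum>g\<in>[{..<M}]\<^bsup>2\<^esup> \<rightarrow>\<^sub>E {..<q}. c ^ card {e\<in>B. missed (\<phi>, g) e})
    \<le> real (card ([{..<M}]\<^bsup>2\<^esup> \<rightarrow>\<^sub>E {..<q})) * (1 + (c - 1) / real q) ^ card B
        * (c ^ D) ^ (card S - card (\<phi> ` S))"
proof -
  let ?E = "[{..<M}]\<^bsup>2\<^esup>"
  have finE: "finite ?E" by (simp add: finite_imp_finite_nsets)
  have finB: "finite B" using assms finite_imp_finite_nsets finite_subset by blast
  obtain R where R: "R \<subseteq> S" "inj_on \<phi> R" "\<phi> ` S = \<phi> ` R"
    using subset_image_inj[of "\<phi> ` S" \<phi> S] by auto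
  have finR: "finite R" using R(1) assms(1) by (rule finite_subset)
  have cR: "card S - card (\<phi> ` S) = card (S - R)"
    using R finR by (simp add: card_Diff_subset card_image)
  define BR where "BR = {e\<in>B. e \<subseteq> R}"
  define F where "F = (`) \<phi> ` BR"
  have inj: "inj_on ((`) \<phi>) BR"
    using R(2) by (auto simp: BR_def inj_on_def inj_on_image_eq_iff)
  have F: "F \<subseteq> ?E"
  proof
    fix f assume "f \<in> F"
    then obtain e where e: "e \<in> B" "e \<subseteq> R" "f = \<phi> ` e" by (auto simp: F_def BR_def)
    have "card f = 2" using e R assms(2) by (auto simp: nsets_def card_image inj_on_subset)
    moreover have "f \<subseteq> \<phi> ` S" using e R(1) by (auto intro: imageI)
    then have "f \<subseteq> {..<M}" using assms(4) by (rule subset_trans)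
    moreover have "finite f" using e finR by (auto intro: finite_subset)
    ultimately show "f \<in> ?E" by (auto simp: nsets_def)
  qed
  have cF: "card F \<le> card B"
  proof -
    have "finite BR" "card BR \<le> card B" unfolding BR_def using finB by (auto intro: card_mono)
    moreover have "card F \<le> card BR" unfolding F_def using \<open>finite BR\<close> by (rule card_image_le)
    ultimately show ?thesis by linarith
  qed
  have split: "card {e\<in>B. missed (\<phi>, g) e} \<le> D * card (S - R) + card {f\<in>F. g f = 0}" for g
  proof -
    let ?N = "{e\<in>BR. g (\<phi> ` e) = 0}"
    have "{e\<in>B. missed (\<phi>, g) e} \<subseteq> (\<Union>v\<in>S - R. {e\<in>B. v \<in> e}) \<union> ?N"
    proof
      fix e assume e: "e \<in> {e\<in>B. missed (\<phi>, g) e}"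
      show "e \<in> (\<Union>v\<in>S - R. {e\<in>B. v \<in> e}) \<union> ?N"
      proof (cases "e \<subseteq> R")
        case True
        then have "\<phi> ` e \<in> F" using e by (auto simp: F_def BR_def)
        then have "card (\<phi> ` e) = 2" using F by (auto simp: nsets_def)
        then show ?thesis using e True by (auto simp: missed_def BR_def)
      next
        case False
        moreover have "e \<subseteq> S" using e assms(2) by (auto simp: nsets_def)
        ultimately show ?thesis using e by auto
      qed
    qed
    then have "card {e\<in>B. missed (\<phi>, g) e} \<le> card ((\<Union>v\<in>S - R. {e\<in>B. v \<in> e}) \<union> ?N)"
      using finB assms(1) by (intro card_mono) (auto simp: BR_def)
    also have "\<dots> \<le> card (\<Union>v\<in>S - R. {e\<in>B. v \<in> e}) + card ?N" by (rule card_Un_le)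
    finally have 1: "card {e\<in>B. missed (\<phi>, g) e} \<le> card (\<Union>v\<in>S - R. {e\<in>B. v \<in> e}) + card ?N" .
    have "card (\<Union>v\<in>S - R. {e\<in>B. v \<in> e}) \<le> (\<Sum>v\<in>S - R. card {e\<in>B. v \<in> e})"
      using assms(1) by (intro card_UN_le) auto
    also have "\<dots> \<le> (\<Sum>v\<in>S - R. D)" by (rule sum_mono) (rule deg)
    finally have 2: "card (\<Union>v\<in>S - R. {e\<in>B. v \<in> e}) \<le> D * card (S - R)" by (simp add: mult.commute)
    have "{f\<in>F. g f = 0} = (`) \<phi> ` ?N" by (auto simp: F_def)
    moreover have "inj_on ((`) \<phi>) ?N" using inj by (rule inj_on_subset) auto
    ultimately have "card ?N = card {f\<in>F. g f = 0}" by (simp add: card_image)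
    then show ?thesis using 1 2 by linarith
  qed
  have "(\<Sum>g\<in>?E \<rightarrow>\<^sub>E {..<q}. c ^ card {e\<in>B. missed (\<phi>, g) e})
    \<le> (\<Sum>g\<in>?E \<rightarrow>\<^sub>E {..<q}. (c ^ D) ^ card (S - R) * c ^ card {f\<in>F. g f = 0})"
  proof (rule sum_mono)
    fix g
    have "c ^ card {e\<in>B. missed (\<phi>, g) e} \<le> c ^ (D * card (S - R) + card {f\<in>F. g f = 0})"
      by (rule power_increasing[OF split \<open>c \<ge> 1\<close>])
    then show "c ^ card {e\<in>B. missed (\<phi>, g) e} \<le> (c ^ D) ^ card (S - R) * c ^ card {f\<in>F. g f = 0}"
      by (simp only: power_add power_mult)
  qed
  also have "\<dots> = (c ^ D) ^ card (S - R) * (real q ^ card ?E * (1 + (c - 1) / real q) ^ card F)"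
    using sum_PiE_power_card_zeros[OF finE F \<open>q \<ge> 1\<close>, of c] by (simp flip: sum_distrib_left)
  also have "\<dots> \<le> (c ^ D) ^ card (S - R) * (real q ^ card ?E * (1 + (c - 1) / real q) ^ card B)"
    using cF assms by (intro mult_left_mono power_increasing) auto
  finally show ?thesis using finE by (simp add: cR card_PiE mult_ac)
qed

text \<open>The bound for a fixed map is averaged over all maps. The factor 2 is the price of
  restricting the graphs to \<open>G\<close>. The factor \<open>exp 1\<close> bounds the collision
  moment with \<open>z = c ^ D\<close>, which is where \<open>k^2 c^D <= M\<close> enters.\<close>

lemma sum_power_missed:
  fixes c :: real
  assumes "finite V" "S \<subseteq> V" "card S \<le> k" "B \<subseteq> [S]\<^bsup>2\<^esup>" and deg: "\<And>v. card {e\<in>B. v \<in> e} \<le> D"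
    and "q \<ge> 1" "M \<ge> 1" "c \<ge> 1" and M: "real k ^ 2 * c ^ D \<le> real M"
    and G: "G \<subseteq> [{..<M}]\<^bsup>2\<^esup> \<rightarrow>\<^sub>E {..<q}" "card ([{..<M}]\<^bsup>2\<^esup> \<rightarrow>\<^sub>E {..<q}) \<le> 2 * card G"
  shows "(\<Sum>w\<in>(V \<rightarrow>\<^sub>E {..<M}) \<times> G. c ^ card {e\<in>B. missed w e})
    \<le> real (card ((V \<rightarrow>\<^sub>E {..<M}) \<times> G)) * (2 * exp 1 * (1 + (c - 1) / real q) ^ card B)"
proof -
  let ?A = "[{..<M}]\<^bsup>2\<^esup> \<rightarrow>\<^sub>E {..<q}" and ?P = "(1 + (c - 1) / real q) ^ card B"
  let ?t = "\<lambda>\<phi>. (c ^ D) ^ (card S - card (\<phi> ` S))"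
  have finA: "finite ?A" by (auto intro: finite_PiE finite_imp_finite_nsets)
  have VS: "V \<inter> S = S" and finS: "finite S" using assms finite_subset by auto
  have cD: "c ^ D \<ge> 1" using \<open>c \<ge> 1\<close> by simp
  have P: "?P \<ge> 0" using \<open>c \<ge> 1\<close> by simp
  have "(\<Sum>w\<in>(V \<rightarrow>\<^sub>E {..<M}) \<times> G. c ^ card {e\<in>B. missed w e})
    = (\<Sum>\<phi>\<in>V \<rightarrow>\<^sub>E {..<M}. \<Sum>g\<in>G. c ^ card {e\<in>B. missed (\<phi>, g) e})"
    by (simp add: sum.cartesian_product case_prod_unfold)
  also have "\<dots> \<le> (\<Sum>\<phi>\<in>V \<rightarrow>\<^sub>E {..<M}. \<Sum>g\<in>?A. c ^ card {e\<in>B. missed (\<phi>, g) e})"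
    using G(1) finA \<open>c \<ge> 1\<close> by (intro sum_mono sum_mono2) auto
  also have "\<dots> \<le> (\<Sum>\<phi>\<in>V \<rightarrow>\<^sub>E {..<M}. real (card ?A) * ?P * ?t \<phi>)"
    using assms finS by (intro sum_mono sum_power_missed_fixed_map) auto
  also have "\<dots> = real (card ?A) * ?P * (\<Sum>\<phi>\<in>V \<rightarrow>\<^sub>E {..<M}. ?t \<phi>)"
    by (simp add: sum_distrib_left)
  also have "\<dots> \<le> real (card ?A) * ?P * (real M ^ card V * exp 1)"
  proof (intro mult_left_mono)
    have "(\<Sum>\<phi>\<in>V \<rightarrow>\<^sub>E {..<M}. ?t \<phi>) \<le> real M ^ card V * (1 + real k * c ^ D / real M) ^ card S"
      using sum_PiE_power_collisions[OF assms(1), of S k M "c ^ D"] assms VS cD by simp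
    also have "(1 + real k * c ^ D / real M) ^ card S \<le> exp (real k * c ^ D / real M) ^ card S"
      using exp_ge_add_one_self[of "real k * c ^ D / real M"] \<open>c \<ge> 1\<close> by (intro power_mono) auto
    also have "\<dots> = exp (real (card S) * (real k * c ^ D / real M))" by (rule exp_of_nat_mult[symmetric])
    also have "\<dots> \<le> exp 1"
    proof -
      have "real (card S) * (real k * c ^ D / real M) \<le> real k * (real k * c ^ D / real M)"
        using assms by (intro mult_right_mono) auto
      also have "\<dots> \<le> 1" using M \<open>M \<ge> 1\<close> by (simp add: field_simps power2_eq_square)
      finally show ?thesis by simp
    qed
    finally show "(\<Sum>\<phi>\<in>V \<rightarrow>\<^sub>E {..<M}. ?t \<phi>) \<le> real M ^ card V * exp 1" by (simp add: mult_left_mono)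
  qed (use P in auto)
  also have "\<dots> \<le> (2 * real (card G)) * ?P * (real M ^ card V * exp 1)"
  proof -
    have "real (card ?A) \<le> 2 * real (card G)" using G(2) by linarith
    then show ?thesis using P by (intro mult_right_mono) auto
  qed
  also have "\<dots> = real (card ((V \<rightarrow>\<^sub>E {..<M}) \<times> G)) * (2 * exp 1 * ?P)"
    using assms(1) by (simp add: card_cartesian_product card_PiE)
  finally show ?thesis .
qed

text \<open>The collision moment with \<open>S = e\<close> and \<open>k = 2\<close>: the image of
  \<open>e\<close> is short of two points exactly when the map is not injective on \<open>e\<close>.
  The graph component plays no part in this event, so \<open>G\<close> is arbitrary.\<close>

lemma sum_noninjective_on_edge:
  fixes y :: real and V :: "nat set" and G :: "'b set"
  assumes "finite V" "e \<in> [V]\<^bsup>2\<^esup>" "M \<ge> 1" "y \<ge> 1"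
  shows "(\<Sum>w\<in>(V \<rightarrow>\<^sub>E {..<M}) \<times> G. if card (fst w ` e) \<noteq> 2 then y else 1)
    \<le> real (card ((V \<rightarrow>\<^sub>E {..<M}) \<times> G)) * (1 + 2 * y / real M) ^ 2"
proof -
  have e: "e \<subseteq> V" "finite e" "card e = 2" "V \<inter> e = e" using assms by (auto simp: nsets_def)
  have "(\<Sum>w\<in>(V \<rightarrow>\<^sub>E {..<M}) \<times> G. if card (fst w ` e) \<noteq> 2 then y else 1)
    \<le> (\<Sum>w\<in>(V \<rightarrow>\<^sub>E {..<M}) \<times> G. y ^ (card e - card (fst w ` e)))"
  proof (rule sum_mono)
    fix w :: "(nat \<Rightarrow> nat) \<times> 'b"
    have "card (fst w ` e) \<le> card e" using e by (intro card_image_le)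
    then show "(if card (fst w ` e) \<noteq> 2 then y else 1) \<le> y ^ (card e - card (fst w ` e))"
      using self_le_power[of y "card e - card (fst w ` e)"] e \<open>y \<ge> 1\<close> by auto
  qed
  also have "\<dots> = real (card G) * (\<Sum>\<phi>\<in>V \<rightarrow>\<^sub>E {..<M}. y ^ (card e - card (\<phi> ` e)))"
    using sum.cartesian_product[of "\<lambda>\<phi> g. y ^ (card e - card (\<phi> ` e))" G "V \<rightarrow>\<^sub>E {..<M}"]
    by (simp add: sum_distrib_left case_prod_unfold)
  also have "\<dots> \<le> real (card G) * (real M ^ card V * (1 + 2 * y / real M) ^ 2)"
    using sum_PiE_power_collisions[OF assms(1), of e 2 M y] assms e by (intro mult_left_mono) auto
  finally show ?thesis using assms(1) by (simp add: card_cartesian_product card_PiE mult_ac)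
qed

section \<open>First-moment method over independent colours\<close>

text \<open>Markov's inequality and a union bound over \<open>J\<close>. For independent uniform
  \<open>\<omega> i\<close> the mean of the product is the product of the means, hence at most
  \<open>K j ^ card I\<close>.\<close>

lemma exists_PiE_prod_less:
  fixes f :: "'j \<Rightarrow> 'w \<Rightarrow> real" and K t :: "'j \<Rightarrow> real"
  assumes "finite I" "finite \<Omega>" "\<Omega> \<noteq> {}" "finite J"
    and f: "\<And>j w. j \<in> J \<Longrightarrow> w \<in> \<Omega> \<Longrightarrow> f j w \<ge> 0"
    and K: "\<And>j. j \<in> J \<Longrightarrow> (\<Sum>w\<in>\<Omega>. f j w) \<le> real (card \<Omega>) * K j"
    and t: "\<And>j. j \<in> J \<Longrightarrow> t j > 0"
    and small: "(\<Sum>j\<in>J. K j ^ card I / t j) < 1"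
  shows "\<exists>\<omega> \<in> I \<rightarrow>\<^sub>E \<Omega>. \<forall>j\<in>J. (\<Prod>i\<in>I. f j (\<omega> i)) < t j"
proof (rule ccontr)
  assume "\<not> ?thesis"
  then have no: "\<exists>j\<in>J. t j \<le> (\<Prod>i\<in>I. f j (\<omega> i))" if "\<omega> \<in> I \<rightarrow>\<^sub>E \<Omega>" for \<omega>
    using that by (meson not_le)
  have nonneg: "0 \<le> (\<Prod>i\<in>I. f j (\<omega> i)) / t j" if "\<omega> \<in> I \<rightarrow>\<^sub>E \<Omega>" "j \<in> J" for \<omega> j
    using that f t by (intro divide_nonneg_pos prod_nonneg) auto
  have "real (card \<Omega>) ^ card I = (\<Sum>\<omega>\<in>I \<rightarrow>\<^sub>E \<Omega>. 1)"
    using assms(1) by (simp add: card_PiE)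
  \<comment> \<open>If every \<open>\<omega>\<close> violates the bound for some \<open>j\<close>,
    then the ratios sum to at least 1 at every \<open>\<omega>\<close>.\<close>
  also have "\<dots> \<le> (\<Sum>\<omega>\<in>I \<rightarrow>\<^sub>E \<Omega>. \<Sum>j\<in>J. (\<Prod>i\<in>I. f j (\<omega> i)) / t j)"
  proof (rule sum_mono)
    fix \<omega> assume \<omega>: "\<omega> \<in> I \<rightarrow>\<^sub>E \<Omega>"
    then obtain j where j: "j \<in> J" "t j \<le> (\<Prod>i\<in>I. f j (\<omega> i))" using no by blast
    then have "1 \<le> (\<Prod>i\<in>I. f j (\<omega> i)) / t j" using t by simp
    also have "\<dots> \<le> (\<Sum>j\<in>J. (\<Prod>i\<in>I. f j (\<omega> i)) / t j)"
      using j(1) nonneg[OF \<omega>] \<open>finite J\<close> by (intro member_le_sum) auto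
    finally show "1 \<le> (\<Sum>j\<in>J. (\<Prod>i\<in>I. f j (\<omega> i)) / t j)" .
  qed
  also have "\<dots> = (\<Sum>j\<in>J. (\<Sum>\<omega>\<in>I \<rightarrow>\<^sub>E \<Omega>. \<Prod>i\<in>I. f j (\<omega> i)) / t j)"
    by (subst sum.swap) (simp add: sum_divide_distrib)
  also have "\<dots> = (\<Sum>j\<in>J. (\<Sum>w\<in>\<Omega>. f j w) ^ card I / t j)"
    using prod_sum_PiE[of I "\<lambda>_. \<Omega>" "\<lambda>_. f j" for j] assms(1,2) by simp
  also have "\<dots> \<le> (\<Sum>j\<in>J. (real (card \<Omega>) * K j) ^ card I / t j)"
    using f K t by (intro sum_mono divide_right_mono power_mono sum_nonneg) (auto simp: less_imp_le)
  also have "\<dots> = real (card \<Omega>) ^ card I * (\<Sum>j\<in>J. K j ^ card I / t j)"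
    by (simp add: power_mult_distrib sum_distrib_left)
  also have "\<dots> < real (card \<Omega>) ^ card I * 1"
    using small assms by (intro mult_strict_left_mono) (auto simp: card_gt_0_iff)
  finally show False by simp
qed

subsection \<open>The colouring\<close>

text \<open>The deterministic half of the argument. \<open>noninj\<close> leaves every edge at least
  \<open>s\<close> colours that are injective on it, and \<open>good\<close> says that
  \<open>b\<close> edges of bounded degree on \<open>k\<close> vertices are never all bad.\<close>

lemma set_colouring_without_mono_clique:
  assumes \<omega>: "\<And>i. i \<in> {1..s + d} \<Longrightarrow> \<omega> i \<in> ({..<n} \<rightarrow>\<^sub>E {..<M}) \<times> dense_nonedges M q h b"
    and noninj: "\<And>e. e \<in> [{..<n}]\<^bsup>2\<^esup> \<Longrightarrow> card {i\<in>{1..s + d}. card (fst (\<omega> i) ` e) \<noteq> 2} \<le> d"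
    and good: "\<And>S B. S \<in> [{..<n}]\<^bsup>k\<^esup> \<Longrightarrow> B \<in> [[S]\<^bsup>2\<^esup>]\<^bsup>b\<^esup> \<Longrightarrow> \<forall>v. card {e\<in>B. v \<in> e} \<le> D
      \<Longrightarrow> \<exists>e\<in>B. card {i\<in>{1..s + d}. missed (\<omega> i) e} \<le> d"
    and D: "2 * b \<le> D * (k - h + 1)" "h \<le> k"
  shows "\<exists>\<chi>. set_colouring (s + d) s n \<chi> \<and> \<not> has_mono_clique (s + d) k n \<chi>"
proof -
  let ?I = "{1..s + d}"
  have avail: "\<exists>X. X \<subseteq> {i\<in>?I. \<not> P i} \<and> card X = s" if "card {i\<in>?I. P i} \<le> d" for P
  proof -
    have "{i\<in>?I. \<not> P i} = ?I - {i\<in>?I. P i}" by auto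
    moreover have "card (?I - {i\<in>?I. P i}) = card ?I - card {i\<in>?I. P i}"
      by (rule card_Diff_subset) auto
    ultimately have "s \<le> card {i\<in>?I. \<not> P i}" using that by simp
    then show ?thesis by (meson obtain_subset_with_card_n)
  qed
  have "\<exists>X. X \<subseteq> ?I \<and> card X = s \<and> (\<forall>i\<in>X. card (fst (\<omega> i) ` e) = 2)
      \<and> (card {i\<in>?I. missed (\<omega> i) e} \<le> d \<longrightarrow> (\<forall>i\<in>X. \<not> missed (\<omega> i) e))"
    if e: "e \<in> [{..<n}]\<^bsup>2\<^esup>" for e
  proof (cases "card {i\<in>?I. missed (\<omega> i) e} \<le> d")
    case True
    from avail[OF this] obtain X where "X \<subseteq> {i\<in>?I. \<not> missed (\<omega> i) e}" "card X = s" by blast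
    then show ?thesis by (intro exI[of _ X]) (auto simp: missed_def)
  next
    case False
    obtain X where "X \<subseteq> {i\<in>?I. \<not> card (fst (\<omega> i) ` e) \<noteq> 2}" "card X = s"
      using avail[OF noninj[OF e]] by blast
    then show ?thesis using False by (intro exI[of _ X]) auto
  qed
  from bchoice[OF ballI, OF this]
  obtain \<chi> where "\<forall>e\<in>[{..<n}]\<^bsup>2\<^esup>. \<chi> e \<subseteq> ?I \<and> card (\<chi> e) = s
      \<and> (\<forall>i\<in>\<chi> e. card (fst (\<omega> i) ` e) = 2)
      \<and> (card {i\<in>?I. missed (\<omega> i) e} \<le> d \<longrightarrow> (\<forall>i\<in>\<chi> e. \<not> missed (\<omega> i) e))" ..
  note \<chi> = bspec[OF this]
  have "set_colouring (s + d) s n \<chi>"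
    unfolding set_colouring_def
  proof (rule funcsetI)
    fix e assume "e \<in> [{..<n}]\<^bsup>2\<^esup>"
    from \<chi>[OF this] have "\<chi> e \<subseteq> ?I" "card (\<chi> e) = s" by auto
    moreover from this(1) have "finite (\<chi> e)" by (rule finite_subset) simp
    ultimately show "\<chi> e \<in> [?I]\<^bsup>s\<^esup>" by (simp add: nsets_def)
  qed
  moreover have "\<not> has_mono_clique (s + d) k n \<chi>"
  proof
    assume "has_mono_clique (s + d) k n \<chi>"
    then obtain S i where S: "S \<in> [{..<n}]\<^bsup>k\<^esup>" and i: "i \<in> ?I" and mono: "\<And>e. e \<in> [S]\<^bsup>2\<^esup> \<Longrightarrow> i \<in> \<chi> e"
      by (auto simp: has_mono_clique_def)
    have S': "S \<subseteq> {..<n}" "finite S" "card S = k" using S by (auto simp: nsets_def)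
    have edge: "e \<in> [{..<n}]\<^bsup>2\<^esup>" if "e \<in> [S]\<^bsup>2\<^esup>" for e using that S'(1) nsets_mono by blast
    obtain \<phi> g where w: "\<omega> i = (\<phi>, g)" by fastforce
    then have \<phi>: "\<phi> \<in> {..<n} \<rightarrow>\<^sub>E {..<M}" and g: "g \<in> dense_nonedges M q h b" using \<omega>[OF i] by auto
    have inj: "inj_on \<phi> S"
    proof (rule inj_onI, rule ccontr)
      fix x y assume xy: "x \<in> S" "y \<in> S" "\<phi> x = \<phi> y" "x \<noteq> y"
      then have e: "{x, y} \<in> [S]\<^bsup>2\<^esup>" by simp
      then have "card (\<phi> ` {x, y}) = 2" using \<chi>[OF edge[OF e]] mono[OF e] w by auto
      then show False using xy by simp
    qed
    let ?H = "{e\<in>[S]\<^bsup>2\<^esup>. g (\<phi> ` e) = 0}"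
    \<comment> \<open>Since the map is injective on the clique, an \<open>h\<close>-subset
      \<open>W\<close> goes to \<open>h\<close> points, and the many non-edges between them pull
      back to edges inside \<open>W\<close>.\<close>
    have dense: "b \<le> card (?H \<inter> [W]\<^bsup>2\<^esup>)" if W: "W \<subseteq> S" "card W = h" for W
    proof -
      have injW: "inj_on \<phi> W" using inj W inj_on_subset by blast
      have finW: "finite W" using W S' finite_subset by blast
      have "\<phi> ` W \<in> [{..<M}]\<^bsup>h\<^esup>" using W S' \<phi> injW finW by (auto simp: nsets_def card_image)
      then have 1: "b \<le> card {f\<in>[\<phi> ` W]\<^bsup>2\<^esup>. g f = 0}" using g by (auto simp: dense_nonedges_def)
      have "{f\<in>[\<phi> ` W]\<^bsup>2\<^esup>. g f = 0} \<subseteq> (`) \<phi> ` (?H \<inter> [W]\<^bsup>2\<^esup>)"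
      proof
        fix f assume f: "f \<in> {f\<in>[\<phi> ` W]\<^bsup>2\<^esup>. g f = 0}"
        then have "f \<subseteq> \<phi> ` W" "card f = 2" by (auto simp: nsets_def)
        then obtain e where e: "e \<subseteq> W" "f = \<phi> ` e" by (meson subset_imageE)
        then have "card e = 2" using \<open>card f = 2\<close> injW by (metis card_image inj_on_subset)
        then have "e \<in> ?H \<inter> [W]\<^bsup>2\<^esup>" using e f W finW finite_subset by (auto simp: nsets_def)
        then show "f \<in> (`) \<phi> ` (?H \<inter> [W]\<^bsup>2\<^esup>)" using e by blast
      qed
      then have "card {f\<in>[\<phi> ` W]\<^bsup>2\<^esup>. g f = 0} \<le> card ((`) \<phi> ` (?H \<inter> [W]\<^bsup>2\<^esup>))"
        using finW by (intro card_mono) (auto simp: finite_imp_finite_nsets)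
      also have "\<dots> \<le> card (?H \<inter> [W]\<^bsup>2\<^esup>)"
        using finW by (intro card_image_le) (auto simp: finite_imp_finite_nsets)
      finally show ?thesis using 1 by linarith
    qed
    \<comment> \<open>All edges in \<open>?H\<close> are bad, since \<open>i\<close> is one of their colours although it misses them.\<close>
    obtain B where B: "B \<subseteq> ?H" "card B = b" "\<And>v. card {e\<in>B. v \<in> e} \<le> D"
      using obtain_bounded_degree_subset[OF S'(2) _ dense] D S'(3) by auto
    have "finite B" using B(1) S'(2) by (auto intro: finite_subset simp: finite_imp_finite_nsets)
    then have "B \<in> [[S]\<^bsup>2\<^esup>]\<^bsup>b\<^esup>" using B by (auto simp: nsets_def[of "[S]\<^bsup>2\<^esup>"])
    then obtain e where e: "e \<in> B" "card {i\<in>?I. missed (\<omega> i) e} \<le> d" using good[OF S] B(3) by blast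
    have "e \<in> ?H" using B(1) e(1) by (rule subsetD)
    then have "e \<in> [S]\<^bsup>2\<^esup>" "g (\<phi> ` e) = 0" by simp_all
    have "missed (\<omega> i) e" unfolding missed_def w using \<open>g (\<phi> ` e) = 0\<close> by simp
    moreover have "\<not> missed (\<omega> i) e"
      using \<chi>[OF edge[OF \<open>e \<in> [S]\<^bsup>2\<^esup>\<close>]] mono[OF \<open>e \<in> [S]\<^bsup>2\<^esup>\<close>] e(2) by blast
    ultimately show False by simp
  qed
  ultimately show ?thesis by blast
qed

text \<open>The probabilistic half. The two summands of \<open>small\<close> are the union bounds
  for \<open>noninj\<close> and \<open>good\<close>; \<open>y\<close> and \<open>c\<close> are the
  bases of the respective exponential moments.\<close>

lemma exists_set_colouring_without_mono_clique:
  fixes c y :: real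
  assumes "M \<ge> 1" "q \<ge> 1" "c > 1" "y > 1"
    and D: "2 * b \<le> D * (k - h + 1)" "h \<le> k"
    and dense: "2 * (real M ^ h * 2 ^ b * exp (- real (h choose 2) / (2 * real q))) \<le> 1"
    and M: "real k ^ 2 * c ^ D \<le> real M"
    and small: "real (n choose 2) * ((1 + 2 * y / real M) ^ 2) ^ (s + d) / y ^ (d + 1)
      + real ((n choose k) * ((k choose 2) choose b)) * (2 * exp 1 * (1 + (c - 1) / real q) ^ b) ^ (s + d)
          / c ^ ((d + 1) * b) < 1"
  shows "\<exists>\<chi>. set_colouring (s + d) s n \<chi> \<and> \<not> has_mono_clique (s + d) k n \<chi>"
proof -
  let ?I = "{1..s + d}" and ?G = "dense_nonedges M q h b" and ?V = "{..<n}"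
  let ?A = "[{..<M}]\<^bsup>2\<^esup> \<rightarrow>\<^sub>E {..<q}"
  let ?W = "(?V \<rightarrow>\<^sub>E {..<M}) \<times> ?G"
  have finA: "finite ?A" by (auto intro: finite_PiE finite_imp_finite_nsets)
  have sub: "?G \<subseteq> ?A" by (auto simp: dense_nonedges_def)
  have half: "card ?A \<le> 2 * card ?G" using card_dense_nonedges[OF \<open>q \<ge> 1\<close> dense] .
  have "card ?A \<noteq> 0" using \<open>q \<ge> 1\<close> by (simp add: card_PiE finite_imp_finite_nsets)
  then have "?G \<noteq> {}" using half by auto
  moreover have "?V \<rightarrow>\<^sub>E {..<M} \<noteq> {}" using \<open>M \<ge> 1\<close> by (auto simp: PiE_eq_empty_iff lessThan_empty_iff)
  moreover have "finite ?G" "finite (?V \<rightarrow>\<^sub>E {..<M})"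
    using finA sub by (auto intro: finite_subset finite_PiE)
  ultimately have W: "finite ?W" "?W \<noteq> {}" by auto
  \<comment> \<open>Only sets of degree at most \<open>D\<close> are tested, as the moment bound
    requires; their number is bounded without using the degrees.\<close>
  define J where "J = {B \<in> \<Union>S\<in>[?V]\<^bsup>k\<^esup>. [[S]\<^bsup>2\<^esup>]\<^bsup>b\<^esup>. \<forall>v. card {e\<in>B. v \<in> e} \<le> D}"
  have finN: "finite ([[S]\<^bsup>2\<^esup>]\<^bsup>b\<^esup>)" if "S \<in> [?V]\<^bsup>k\<^esup>" for S
    using that by (auto simp: nsets_def intro: finite_imp_finite_nsets)
  have finU: "finite (\<Union>S\<in>[?V]\<^bsup>k\<^esup>. [[S]\<^bsup>2\<^esup>]\<^bsup>b\<^esup>)"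
    using finN by (auto simp: finite_imp_finite_nsets)
  then have finJ: "finite J" by (rule finite_subset[rotated]) (auto simp: J_def)
  have cJ: "card J \<le> (n choose k) * ((k choose 2) choose b)"
  proof -
    have "card J \<le> card (\<Union>S\<in>[?V]\<^bsup>k\<^esup>. [[S]\<^bsup>2\<^esup>]\<^bsup>b\<^esup>)" using finU by (auto simp: J_def intro!: card_mono)
    also have "\<dots> \<le> (\<Sum>S\<in>[?V]\<^bsup>k\<^esup>. card ([[S]\<^bsup>2\<^esup>]\<^bsup>b\<^esup>))"
      by (intro card_UN_le) (simp add: finite_imp_finite_nsets)
    also have "\<dots> = (\<Sum>S\<in>[?V]\<^bsup>k\<^esup>. (k choose 2) choose b)"
    proof (rule sum.cong)
      fix S assume "S \<in> [?V]\<^bsup>k\<^esup>"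
      then have "card S = k" by (simp add: nsets_def)
      then show "card ([[S]\<^bsup>2\<^esup>]\<^bsup>b\<^esup>) = (k choose 2) choose b" by simp
    qed simp
    finally show ?thesis by simp
  qed
  \<comment> \<open>The sum type merges both families of events: \<open>Inl e\<close> weighs the
    colours that are not injective on \<open>e\<close>, and \<open>Inr B\<close> weighs the edges of
    \<open>B\<close> missed by a colour.\<close>
  define f where "f = case_sum (\<lambda>e w. if card (fst w ` e) \<noteq> 2 then y else 1)
      (\<lambda>B w. c ^ card {e\<in>B. missed w e})"
  define K where "K = case_sum (\<lambda>_::nat set. (1 + 2 * y / real M) ^ 2)
      (\<lambda>_::nat set set. 2 * exp 1 * (1 + (c - 1) / real q) ^ b)"
  define t where "t = case_sum (\<lambda>_::nat set. y ^ (d + 1)) (\<lambda>_::nat set set. c ^ ((d + 1) * b))"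
  have "\<exists>\<omega> \<in> ?I \<rightarrow>\<^sub>E ?W. \<forall>j \<in> [?V]\<^bsup>2\<^esup> <+> J. (\<Prod>i\<in>?I. f j (\<omega> i)) < t j"
  proof (rule exists_PiE_prod_less[where K = K])
    show "finite ([?V]\<^bsup>2\<^esup> <+> J)" using finJ by (simp add: finite_imp_finite_nsets)
    show "0 \<le> f j w" if "j \<in> [?V]\<^bsup>2\<^esup> <+> J" "w \<in> ?W" for j w
      using \<open>c > 1\<close> \<open>y > 1\<close> by (auto simp: f_def split: sum.split)
    show "t j > 0" if "j \<in> [?V]\<^bsup>2\<^esup> <+> J" for j
      using \<open>c > 1\<close> \<open>y > 1\<close> by (auto simp: t_def split: sum.split)
    show "(\<Sum>w\<in>?W. f j w) \<le> real (card ?W) * K j" if j: "j \<in> [?V]\<^bsup>2\<^esup> <+> J" for j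
    proof (cases j)
      case (Inl e)
      then show ?thesis
        using sum_noninjective_on_edge[of ?V e M y ?G] j \<open>M \<ge> 1\<close> \<open>y > 1\<close>
        by (auto simp: f_def K_def)
    next
      case (Inr B)
      then obtain S where S: "S \<in> [?V]\<^bsup>k\<^esup>" "B \<in> [[S]\<^bsup>2\<^esup>]\<^bsup>b\<^esup>" "\<forall>v. card {e\<in>B. v \<in> e} \<le> D"
        using j by (auto simp: J_def)
      then have "S \<subseteq> ?V" "card S \<le> k" "B \<subseteq> [S]\<^bsup>2\<^esup>" "card B = b" by (auto simp: nsets_def)
      then show ?thesis
        using sum_power_missed[of ?V S k B D q M c ?G] S(3) assms(1-4) M sub half Inr
        by (auto simp: f_def K_def)
    qed
    have "(\<Sum>j\<in>[?V]\<^bsup>2\<^esup> <+> J. K j ^ card ?I / t j)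
      = real (n choose 2) * ((1 + 2 * y / real M) ^ 2) ^ (s + d) / y ^ (d + 1)
      + real (card J) * ((2 * exp 1 * (1 + (c - 1) / real q) ^ b) ^ (s + d) / c ^ ((d + 1) * b))"
      using finJ by (subst sum.Plus) (simp_all add: finite_imp_finite_nsets K_def t_def)
    also have "\<dots> \<le> real (n choose 2) * ((1 + 2 * y / real M) ^ 2) ^ (s + d) / y ^ (d + 1)
      + real ((n choose k) * ((k choose 2) choose b)) *
        ((2 * exp 1 * (1 + (c - 1) / real q) ^ b) ^ (s + d) / c ^ ((d + 1) * b))"
      using cJ \<open>c > 1\<close>
      by (intro add_left_mono mult_right_mono of_nat_mono divide_nonneg_pos zero_le_power) auto
    finally show "(\<Sum>j\<in>[?V]\<^bsup>2\<^esup> <+> J. K j ^ card ?I / t j) < 1" using small by simp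
  qed (use W in auto)
  then obtain \<omega> where \<omega>: "\<omega> \<in> ?I \<rightarrow>\<^sub>E ?W"
    and prod: "\<And>j. j \<in> [?V]\<^bsup>2\<^esup> <+> J \<Longrightarrow> (\<Prod>i\<in>?I. f j (\<omega> i)) < t j" by blast
  show ?thesis
  proof (rule set_colouring_without_mono_clique[where \<omega> = \<omega> and D = D and b = b and h = h])
    show "\<omega> i \<in> ?W" if "i \<in> ?I" for i using \<omega> that by (rule PiE_mem)
    show "card {i\<in>?I. card (fst (\<omega> i) ` e) \<noteq> 2} \<le> d" if "e \<in> [?V]\<^bsup>2\<^esup>" for e
    proof -
      have "(\<Prod>i\<in>?I. f (Inl e) (\<omega> i)) = y ^ card {i\<in>?I. card (fst (\<omega> i) ` e) \<noteq> 2}"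
        unfolding f_def sum.case by (subst prod.inter_filter[symmetric]) auto
      then have "y ^ card {i\<in>?I. card (fst (\<omega> i) ` e) \<noteq> 2} < y ^ (d + 1)"
        using prod[OF InlI[OF that]] by (simp add: t_def)
      from power_less_imp_less_exp[OF \<open>y > 1\<close> this] show ?thesis by simp
    qed
    show "\<exists>e\<in>B. card {i\<in>?I. missed (\<omega> i) e} \<le> d"
      if "S \<in> [?V]\<^bsup>k\<^esup>" and B: "B \<in> [[S]\<^bsup>2\<^esup>]\<^bsup>b\<^esup>" and "\<forall>v. card {e\<in>B. v \<in> e} \<le> D" for S B
    proof (rule ccontr)
      assume "\<not> ?thesis"
      then have many: "d + 1 \<le> card {i\<in>?I. missed (\<omega> i) e}" if "e \<in> B" for e
        using that by (auto simp: not_le)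
      have finB: "finite B" and cB: "card B = b" using B by (auto simp: nsets_def[of "[S]\<^bsup>2\<^esup>"])
      \<comment> \<open>Counting pairs of an edge and a colour missing it: if all \<open>b\<close>
        edges were bad, the total exponent would reach the threshold in \<open>t\<close>.\<close>
      have "(d + 1) * b \<le> (\<Sum>e\<in>B. card {i\<in>?I. missed (\<omega> i) e})"
        using sum_bounded_below[of B "d + 1", OF many] cB by (simp add: mult.commute)
      also have "\<dots> = (\<Sum>e\<in>B. \<Sum>i\<in>?I. if missed (\<omega> i) e then 1 else 0)"
        by (simp flip: sum.inter_filter)
      also have "\<dots> = (\<Sum>i\<in>?I. \<Sum>e\<in>B. if missed (\<omega> i) e then 1 else 0)" by (rule sum.swap)
      also have "\<dots> = (\<Sum>i\<in>?I. card {e\<in>B. missed (\<omega> i) e})"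
        using finB by (simp flip: sum.inter_filter)
      finally have "c ^ ((d + 1) * b) \<le> (\<Prod>i\<in>?I. f (Inr B) (\<omega> i))"
        using \<open>c > 1\<close> by (simp add: f_def flip: power_sum del: mult_Suc add_Suc_right)
      moreover have "B \<in> J" using that by (auto simp: J_def)
      ultimately show False using prod[OF InrI, of B] by (simp add: t_def)
    qed
  qed (use D in auto)
qed

text \<open>The least number only speaks about itself, so monotonicity is needed: a colouring of a
  larger complete graph restricts to the smaller one, and a clique found there is also a clique of
  the larger graph.\<close>

lemma less_set_colouring_Ramsey:
  assumes "1 \<le> s" "s \<le> r" "set_colouring r s n \<chi>" "\<not> has_mono_clique r k n \<chi>"
  shows "n < set_colouring_Ramsey r s k"
proof (rule ccontr)
  let ?P = "\<lambda>n. \<forall>\<chi>. set_colouring r s n \<chi> \<longrightarrow> has_mono_clique r k n \<chi>"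
  let ?m = "set_colouring_Ramsey r s k"
  have m: "?P ?m"
    unfolding set_colouring_Ramsey_def using set_colouring_Ramsey_exists[OF assms(1,2)] by (rule LeastI_ex)
  assume "\<not> n < ?m"
  then have le: "{..<?m} \<subseteq> {..<n}" by auto
  then have "set_colouring r s ?m \<chi>"
    using assms(3) nsets_Pi_contra[OF le] unfolding set_colouring_def by blast
  then have "has_mono_clique r k ?m \<chi>" using m by blast
  then have "has_mono_clique r k n \<chi>"
    unfolding has_mono_clique_def using nsets_mono[OF le] by blast
  then show False using assms(4) by blast
qed

subsection \<open>Choice of parameters\<close>

text \<open>One term of the expansion of \<open>(1 + x) ^ N\<close> is at most the whole sum. Later
  \<open>x = d / r\<close>, which makes \<open>N x\<close> comparable to \<open>b\<close>.\<close>

lemma binomial_le_exp: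
  assumes "0 < x"
  shows "real (N choose b) \<le> exp (real N * x) / x ^ b"
proof -
  have "real (N choose b) * x ^ b \<le> (\<Sum>i\<le>N. real (N choose i) * x ^ i)"
  proof (cases "b \<le> N")
    case True
    then show ?thesis using assms by (intro member_le_sum[where f = "\<lambda>i. real (N choose i) * x ^ i"]) auto
  next
    case False
    then show ?thesis using assms by (simp add: binomial_eq_0 sum_nonneg)
  qed
  also have "\<dots> = (x + 1) ^ N" using binomial_ring[of x 1 N] by simp
  also have "\<dots> \<le> exp x ^ N" using exp_ge_add_one_self[of x] assms by (intro power_mono) (auto simp: add.commute)
  also have "\<dots> = exp (real N * x)" by (rule exp_of_nat_mult[symmetric])
  finally show ?thesis using assms by (simp add: field_simps)
qed

lemma nat_floor_bounds:
  fixes x :: real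
  assumes "1 \<le> x"
  shows "x / 2 \<le> real (nat \<lfloor>x\<rfloor>)" "real (nat \<lfloor>x\<rfloor>) \<le> x" "x < real (nat \<lfloor>x\<rfloor>) + 1" "1 \<le> nat \<lfloor>x\<rfloor>"
proof -
  have 1: "1 \<le> \<lfloor>x\<rfloor>" using assms by simp
  then have "real (nat \<lfloor>x\<rfloor>) = of_int \<lfloor>x\<rfloor>" by simp
  moreover have "1 \<le> real_of_int \<lfloor>x\<rfloor>" using 1 by simp
  ultimately show "x / 2 \<le> real (nat \<lfloor>x\<rfloor>)" "real (nat \<lfloor>x\<rfloor>) \<le> x" "x < real (nat \<lfloor>x\<rfloor>) + 1"
    using floor_correct[of x] by - linarith+
  show "1 \<le> nat \<lfloor>x\<rfloor>" using 1 by linarith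
qed

lemma nat_ceiling_bounds:
  fixes x :: real
  assumes "1 \<le> x"
  shows "x \<le> real (nat \<lceil>x\<rceil>)" "real (nat \<lceil>x\<rceil>) \<le> 2 * x" "1 \<le> nat \<lceil>x\<rceil>"
proof -
  have 1: "1 \<le> \<lceil>x\<rceil>" using assms by linarith
  then have "real (nat \<lceil>x\<rceil>) = of_int \<lceil>x\<rceil>" by simp
  then show "x \<le> real (nat \<lceil>x\<rceil>)" "real (nat \<lceil>x\<rceil>) \<le> 2 * x"
    using ceiling_correct[of x] assms by - linarith+
  show "1 \<le> nat \<lceil>x\<rceil>" using 1 by linarith
qed

text \<open>As \<open>Y\<close> is at least \<open>10^9\<close> times the logarithm of
  \<open>r\<close>, both \<open>r\<close> and \<open>k <= Y r\<close> are negligible against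
  \<open>exp (Y / 800)\<close>.\<close>

lemma polynomial_le_exp:
  fixes Y :: real and k r :: nat
  assumes big: "500000000 \<le> Y" and kr: "real k \<le> Y * real r" and rC: "real r \<le> exp (Y / 10 ^ 9)"
  shows "2 * real k ^ 2 \<le> exp (Y / 800)" "8 * real r \<le> exp (Y / 800)"
proof -
  have YY: "2 * Y ^ 2 \<le> exp (Y / 1600)"
  proof -
    \<comment> \<open>This prepares the fourth power of \<open>x <= exp x\<close> at
      \<open>x = Y / 6400\<close>.\<close>
    have "2 * 6400 ^ 4 * Y ^ 2 \<le> Y ^ 2 * Y ^ 2"
    proof (rule mult_right_mono)
      have "500000000 ^ 2 \<le> Y ^ 2" using big by (intro power_mono) auto
      then show "2 * 6400 ^ 4 \<le> Y ^ 2" by simp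
    qed simp
    then have "2 * Y ^ 2 \<le> (Y / 6400) ^ 4" by (simp add: power_divide field_simps)
    also have "\<dots> \<le> exp (Y / 6400) ^ 4"
    proof (rule power_mono)
      show "Y / 6400 \<le> exp (Y / 6400)" using exp_ge_add_one_self[of "Y / 6400"] by linarith
      show "0 \<le> Y / 6400" using big by simp
    qed
    also have "\<dots> = exp (real 4 * (Y / 6400))" by (rule exp_of_nat_mult[symmetric])
    also have "real 4 * (Y / 6400) = Y / 1600" by simp
    finally show ?thesis .
  qed
  show "2 * real k ^ 2 \<le> exp (Y / 800)"
  proof -
    have "2 * real k ^ 2 \<le> 2 * (Y * exp (Y / 10 ^ 9)) ^ 2"
    proof (intro mult_left_mono power_mono)
      have "Y * real r \<le> Y * exp (Y / 10 ^ 9)" using rC big by (intro mult_left_mono) auto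
      then show "real k \<le> Y * exp (Y / 10 ^ 9)" using kr by linarith
    qed auto
    also have "\<dots> = (2 * Y ^ 2) * exp (2 * (Y / 10 ^ 9))"
      by (simp add: power_mult_distrib power2_eq_square flip: exp_add)
    also have "\<dots> \<le> exp (Y / 1600) * exp (Y / 1600)" using YY big by (intro mult_mono) auto
    finally show ?thesis by (simp flip: exp_add)
  qed
  show "8 * real r \<le> exp (Y / 800)"
  proof -
    have "8 \<le> exp (Y / 1600)" using exp_ge_add_one_self[of "Y / 1600"] big by linarith
    moreover have "real r \<le> exp (Y / 1600)"
      by (rule order_trans[OF rC]) (use big in simp)
    ultimately have "8 * real r \<le> exp (Y / 1600) * exp (Y / 1600)" by (intro mult_mono) auto
    then show ?thesis by (simp flip: exp_add)
  qed
qed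

section \<open>The three smallness conditions\<close>

text \<open>In units of \<open>k Y\<close> the exponents are about \<open>1/800\<close> for
  \<open>M ^ h\<close> and at most \<open>1/320\<close> for \<open>2 ^ b\<close>, against a gain of
  \<open>1/130\<close>.\<close>

lemma dense_nonedges_bound:
  fixes Y :: real and k b M q :: nat
  defines "h \<equiv> (k + 1) div 2"
  assumes big: "500000000 \<le> Y" and kY: "Y \<le> real k"
    and M: "real M \<le> exp (Y / 400)" and b: "real b \<le> real k * Y / 320"
    and q: "1 \<le> q" "real q * Y \<le> 8 * real k"
  shows "2 * (real M ^ h * 2 ^ b * exp (- real (h choose 2) / (2 * real q))) \<le> 1"
proof -
  have k0: "0 < real k" using big kY by linarith
  have two: "2 \<le> exp (1::real)" using exp_ge_add_one_self[of 1] by simp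
  have "k \<le> 2 * h" "2 * h \<le> k + 1" unfolding h_def by linarith+
  then have "real k \<le> real (2 * h)" "real (2 * h) \<le> real (k + 1)" by (simp_all only: of_nat_le_iff)
  then have h: "real k / 2 \<le> real h" "real h \<le> (real k + 1) / 2" by simp_all
  have "real M ^ h \<le> exp (Y / 400) ^ h" using M by (intro power_mono) auto
  also have "\<dots> = exp (real h * (Y / 400))" by (rule exp_of_nat_mult[symmetric])
  also have "\<dots> \<le> exp ((real k + 1) / 2 * (Y / 400))" using h big by (simp add: mult_right_mono)
  finally have 1: "real M ^ h \<le> exp ((real k + 1) / 2 * (Y / 400))" .
  have "2 ^ b \<le> exp (1::real) ^ b" using two by (intro power_mono) auto
  also have "\<dots> = exp (real b)" using exp_of_nat_mult[of b "1::real"] by simp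
  finally have 2: "(2::real) ^ b \<le> exp (real k * Y / 320)" using b by (smt (verit) exp_le_cancel_iff)
  \<comment> \<open>Here \<open>h choose 2\<close> is at least \<open>99/800 k^2\<close> and
    \<open>q\<close> is at most \<open>8 k / Y\<close>; the quotient \<open>99/12800\<close> exceeds
    \<open>1/130\<close>.\<close>
  have 3: "real k * Y / 130 \<le> real (h choose 2) / (2 * real q)"
  proof -
    have "real (h choose 2) = real h * (real h - 1) / 2"
    proof -
      have "even (h * (h - 1))" by auto
      then have "real (h choose 2) = real (h * (h - 1)) / 2"
        unfolding choose_two using real_of_nat_div[of 2 "h * (h - 1)"] by auto
      moreover have "h \<ge> 1" using h kY big by linarith
      ultimately show ?thesis by (simp add: of_nat_diff)
    qed
    moreover have "(real k / 2) * (99 / 100 * (real k / 2)) \<le> real h * (real h - 1)"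
      using h kY big by (intro mult_mono) auto
    ultimately have "99 / 800 * (real k * real k) \<le> real (h choose 2)" by simp
    moreover have "Y / (16 * real k) \<le> 1 / (2 * real q)"
      using q k0 by (simp add: field_simps)
    ultimately have "99 / 800 * (real k * real k) * (Y / (16 * real k)) \<le> real (h choose 2) * (1 / (2 * real q))"
      using big k0 by (intro mult_mono) auto
    also have "99 / 800 * (real k * real k) * (Y / (16 * real k)) = 99 / 12800 * (real k * Y)"
      using k0 by simp
    finally have "99 / 12800 * (real k * Y) \<le> real (h choose 2) / (2 * real q)" by simp
    moreover have "0 \<le> real k * Y" using big by simp
    ultimately show ?thesis by linarith
  qed
  have "2 * (real M ^ h * 2 ^ b * exp (- real (h choose 2) / (2 * real q)))
    \<le> exp 1 * (exp ((real k + 1) / 2 * (Y / 400)) * exp (real k * Y / 320) * exp (- (real k * Y / 130)))"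
    by (intro mult_mono 1 2 two) (use 3 in auto)
  also have "\<dots> = exp (1 + (real k + 1) / 2 * (Y / 400) + real k * Y / 320 - real k * Y / 130)"
    by (simp add: mult_exp_exp)
  also have "\<dots> \<le> exp 0"
  proof -
    define P where "P = real k * Y"
    have "500000000 * Y \<le> P" unfolding P_def using kY big by (intro mult_right_mono) auto
    then have "1 + (P + Y) / 800 + P / 320 - P / 130 \<le> 0" using big by (simp add: field_simps)
    moreover have "(real k + 1) / 2 * (Y / 400) = (P + Y) / 800" by (simp add: P_def field_simps)
    ultimately show ?thesis by (simp add: P_def)
  qed
  finally show ?thesis by simp
qed

text \<open>The \<open>r\<close> colours together contribute at most \<open>exp 1\<close>, because
  \<open>4 r y <= M\<close>. The threshold is at least \<open>exp (d Y / 800)\<close>, which beats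
  the roughly \<open>n^2\<close> edges.\<close>

lemma noninjective_bound:
  fixes Y y :: real and n d r M :: nat
  defines "y \<equiv> exp (Y / 800)"
  assumes big: "500000000 \<le> Y" and d: "1 \<le> d"
    and n: "real n \<le> exp (real d * Y / 10 ^ 5)"
    and M: "exp (Y / 400) / 2 \<le> real M" and rr: "8 * real r \<le> exp (Y / 800)"
  shows "real (n choose 2) * ((1 + 2 * y / real M) ^ 2) ^ r / y ^ (d + 1) \<le> exp (-2)"
proof -
  have "n choose 2 \<le> n ^ 2" by (cases "2 \<le> n") (auto simp: binomial_le_pow binomial_eq_0)
  then have "real (n choose 2) \<le> real n ^ 2" by (metis of_nat_le_iff of_nat_power)
  also have "\<dots> \<le> exp (real d * Y / 10 ^ 5) ^ 2" using n by (intro power_mono) auto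
  also have "\<dots> = exp (2 * (real d * Y / 10 ^ 5))" by (rule exp_double[symmetric])
  finally have 1: "real (n choose 2) \<le> exp (2 * (real d * Y / 10 ^ 5))" .
  have "((1 + 2 * y / real M) ^ 2) ^ r \<le> (exp (2 * y / real M) ^ 2) ^ r"
    using exp_ge_add_one_self[of "2 * y / real M"] by (intro power_mono) (auto simp: y_def)
  also have "\<dots> = exp (4 * real r * y / real M)"
    using exp_of_nat_mult[of "2 * r" "2 * y / real M"] by (simp add: power_mult mult.assoc)
  also have "\<dots> \<le> exp 1"
  proof -
    have "8 * real r * y \<le> exp (Y / 800) * exp (Y / 800)"
      using rr by (simp add: y_def)
    then have "4 * real r * y \<le> real M" using M by (simp flip: exp_add)
    moreover have "0 < real M" using M exp_gt_zero[of "Y / 400"] by linarith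
    ultimately show ?thesis by simp
  qed
  finally have 2: "((1 + 2 * y / real M) ^ 2) ^ r \<le> exp 1" .
  have "y ^ (d + 1) = exp (real (d + 1) * (Y / 800))" unfolding y_def by (rule exp_of_nat_mult[symmetric])
  then have 3: "exp (real d * (Y / 800)) \<le> y ^ (d + 1)" using big by (simp add: distrib_right)
  have "real (n choose 2) * ((1 + 2 * y / real M) ^ 2) ^ r / y ^ (d + 1)
    \<le> exp (2 * (real d * Y / 10 ^ 5)) * exp 1 / exp (real d * (Y / 800))"
    by (intro frac_le mult_mono 1 2 3) auto
  also have "\<dots> = exp (2 * (real d * Y / 10 ^ 5) + 1 - real d * (Y / 800))"
    by (simp only: exp_add exp_diff)
  also have "\<dots> \<le> exp (-2)"
  proof -
    have "1 * 500000000 \<le> real d * Y" using big d by (intro mult_mono) auto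
    then show ?thesis by (simp add: mult.commute[of Y])
  qed
  finally show ?thesis .
qed

text \<open>All exponents are compared with \<open>P = b d\<close>. The threshold gains
  \<open>P / 10\<close>. The moments cost \<open>P / 20 + 2 r\<close>, choosing the vertices costs
  \<open>P / 125\<close>, and choosing the edges costs \<open>(400 + ln r) b\<close>, which is small
  because \<open>d\<close> is large compared with \<open>ln r\<close>.\<close>

lemma missed_bound:
  fixes Y c :: real and n d r k b q :: nat
  defines "c \<equiv> exp (1 / 10)"
  assumes big: "500000000 \<le> Y" "500000000 \<le> real d" and "d \<le> r" and d: "1000000000 * ln (real r) \<le> real d"
    and kd: "real k * real d = Y * real r" and b: "real k * Y / 800 \<le> real b"
    and n: "real n \<le> exp (real d * Y / 10 ^ 5)" and q: "4 * real r \<le> real q * real d"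
  shows "real ((n choose k) * ((k choose 2) choose b)) * (2 * exp 1 * (1 + (c - 1) / real q) ^ b) ^ r
    / c ^ ((d + 1) * b) \<le> exp (-2)"
proof -
  define L where "L = ln (real r)"
  have r: "500000000 \<le> real r" "0 < real d" "real d \<le> real r" using big \<open>d \<le> r\<close> by auto
  then have rL: "exp L = real r" by (simp add: L_def)
  have "n choose k \<le> n ^ k" by (cases "k \<le> n") (auto simp: binomial_le_pow binomial_eq_0)
  then have "real (n choose k) \<le> real n ^ k" by (metis of_nat_le_iff of_nat_power)
  also have "\<dots> \<le> exp (real d * Y / 10 ^ 5) ^ k" using n by (intro power_mono) auto
  also have "\<dots> = exp (real k * (real d * Y / 10 ^ 5))" by (rule exp_of_nat_mult[symmetric])
  also have "\<dots> \<le> exp (1 / 125 * (real b * real d))"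
  proof -
    have "real k * Y * real d \<le> 800 * real b * real d" using b by (intro mult_right_mono) auto
    then show ?thesis by (simp add: mult_ac)
  qed
  finally have 1: "real (n choose k) \<le> exp (1 / 125 * (real b * real d))" .
  have "real ((k choose 2) choose b) \<le> exp (real (k choose 2) * (real d / real r)) / (real d / real r) ^ b"
    using r by (intro binomial_le_exp) auto
  also have "\<dots> \<le> exp (400 * real b) / exp (- L * real b)"
  proof (rule frac_le)
    have "real (k choose 2) \<le> real k * real k / 2"
    proof -
      have "k choose 2 \<le> k * k div 2" unfolding choose_two by (intro div_le_mono mult_le_mono) auto
      then have "2 * (k choose 2) \<le> k * k" by linarith
      then have "real (2 * (k choose 2)) \<le> real (k * k)" by (simp only: of_nat_le_iff)
      then show ?thesis by simp
    qed
    then have "real (k choose 2) * (real d / real r) \<le> real k * real k / 2 * (real d / real r)"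
      by (intro mult_right_mono) auto
    also have "\<dots> = real k * (real k * real d) / (2 * real r)" by simp
    also have "\<dots> = real k * Y / 2" unfolding kd using r by simp
    also have "\<dots> \<le> 400 * real b" using b by simp
    finally show "exp (real (k choose 2) * (real d / real r)) \<le> exp (400 * real b)" by simp
    have "exp (- L) ^ b \<le> (real d / real r) ^ b"
      using r big(2) by (intro power_mono) (auto simp: rL exp_minus field_simps)
    then show "exp (- L * real b) \<le> (real d / real r) ^ b"
      using exp_of_nat_mult[of b "- L"] by (simp add: mult.commute)
  qed auto
  also have "\<dots> = exp (400 * real b + L * real b)" by (simp add: exp_add exp_minus field_simps)
  finally have 2: "real ((k choose 2) choose b) \<le> exp (400 * real b + L * real b)" .
  have c: "1 < c" "c - 1 \<le> 1 / 5" using exp_bound[of "1 / 10"] by (auto simp: c_def power2_eq_square)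
  have "(2 * exp 1 * (1 + (c - 1) / real q) ^ b) ^ r \<le> exp (2 + real b * ((c - 1) / real q)) ^ r"
  proof (rule power_mono)
    have "(1 + (c - 1) / real q) ^ b \<le> exp ((c - 1) / real q) ^ b"
      using exp_ge_add_one_self[of "(c - 1) / real q"] c by (intro power_mono) auto
    then have "(1 + (c - 1) / real q) ^ b \<le> exp (real b * ((c - 1) / real q))"
      by (simp only: exp_of_nat_mult)
    moreover have "2 * exp 1 \<le> exp (2::real)"
      using mult_right_mono[of 2 "exp 1" "exp (1::real)"] exp_ge_add_one_self[of 1] mult_exp_exp[of 1 "1::real"]
      by simp
    ultimately have "2 * exp 1 * (1 + (c - 1) / real q) ^ b \<le> exp 2 * exp (real b * ((c - 1) / real q))"
      using c by (intro mult_mono) auto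
    then show "2 * exp 1 * (1 + (c - 1) / real q) ^ b \<le> exp (2 + real b * ((c - 1) / real q))"
      by (simp add: exp_add)
  qed (use c in auto)
  also have "\<dots> = exp (real r * (2 + real b * ((c - 1) / real q)))"
    by (rule exp_of_nat_mult[symmetric])
  also have "\<dots> \<le> exp (2 * real r + real b * real d / 20)"
  proof -
    have "real r / real q \<le> real d / 4" 
    proof -
      have "0 < real q * real d" using q r by linarith
      then have "0 < real q" using r by (simp add: zero_less_mult_iff)
      then show ?thesis using q by (simp add: field_simps)
    qed
    then have "(c - 1) * (real r / real q) \<le> 1 / 5 * (real d / 4)" using c by (intro mult_mono) auto
    then have "real b * ((c - 1) * (real r / real q)) \<le> real b * (1 / 5 * (real d / 4))"
      by (rule mult_left_mono) simp
    then show ?thesis by (simp add: field_simps)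
  qed
  finally have 3: "(2 * exp 1 * (1 + (c - 1) / real q) ^ b) ^ r \<le> exp (2 * real r + real b * real d / 20)" .
  have "c ^ ((d + 1) * b) = exp (real ((d + 1) * b) * (1 / 10))"
    unfolding c_def by (rule exp_of_nat_mult[symmetric])
  then have 4: "exp (real b * real d / 10) \<le> c ^ ((d + 1) * b)" by (simp add: field_simps)
  have "real ((n choose k) * ((k choose 2) choose b)) * (2 * exp 1 * (1 + (c - 1) / real q) ^ b) ^ r
      / c ^ ((d + 1) * b)
    \<le> exp (1 / 125 * (real b * real d)) * exp (400 * real b + L * real b) * exp (2 * real r + real b * real d / 20)
      / exp (real b * real d / 10)"
    unfolding of_nat_mult by (intro frac_le mult_mono 1 2 3 4) (use c in auto)
  also have "\<dots> = exp (1 / 125 * (real b * real d) + (400 * real b + L * real b)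
      + (2 * real r + real b * real d / 20) - real b * real d / 10)"
    by (simp only: exp_add exp_diff)
  also have "\<dots> \<le> exp (-2)"
  proof -
    define P where "P = real b * real d"
    have "40000000 * real b \<le> P"
      unfolding P_def mult.commute[of "real b"] using big by (intro mult_right_mono) auto
    moreover have "1000000000 * (L * real b) \<le> P"
      using mult_right_mono[OF d, of "real b"] by (simp add: P_def L_def mult_ac)
    moreover have "100000 * real r \<le> P"
    proof -
      have "500000000 * 500000000 \<le> Y * Y" using big by (intro mult_mono) auto
      then have "100000 * real r \<le> Y * Y / 800 * real r" by (intro mult_right_mono) auto
      also have "\<dots> = Y * (real k * real d) / 800" unfolding kd by simp
      also have "\<dots> = real k * Y / 800 * real d" by simp
      also have "\<dots> \<le> P" unfolding P_def using b by (intro mult_right_mono) auto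
      finally show ?thesis .
    qed
    ultimately have "1 / 125 * P + (400 * real b + L * real b) + (2 * real r + P / 20) - P / 10 \<le> -2"
      using r by (simp add: field_simps)
    then show ?thesis by (simp add: P_def)
  qed
  finally show ?thesis .
qed

lemma set_colouring_Ramsey_greater:
  fixes r s d k :: nat and Y :: real
  defines "Y \<equiv> real k * real d / real r"
  assumes "1 \<le> s" "1 \<le> d" "r = s + d"
    and d: "10 ^ 9 * ln (real r) \<le> real d" and Y: "10 ^ 9 * ln (real r) \<le> Y"
  shows "exp (real d * Y / 10 ^ 5) < real (set_colouring_Ramsey r s k)"
proof -
  have r: "real r \<ge> 2" "real d \<le> real r" "0 < real d" using assms by auto
  \<comment> \<open>With \<open>r >= 2\<close> this turns both logarithmic hypotheses into absolute
    lower bounds on \<open>d\<close> and \<open>Y\<close>.\<close>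
  have "1 / 2 \<le> ln (2::real)" using exp_half_le2 ln_ge_iff[of 2 "1 / 2"] by linarith
  also have "\<dots> \<le> ln (real r)" using r by simp
  finally have big: "500000000 \<le> real d" "500000000 \<le> Y" using d Y by auto
  have kd: "real k * real d = Y * real r" using r by (simp add: Y_def)
  have kY: "Y \<le> real k"
  proof -
    have "Y * real r \<le> real k * real r" unfolding kd[symmetric] using r by (intro mult_left_mono) auto
    then show ?thesis using r by simp
  qed
  have kr: "real k \<le> Y * real r"
    unfolding kd[symmetric] using \<open>1 \<le> d\<close> by (simp add: mult_le_cancel_left1)
  have rY: "real r \<le> exp (Y / 10 ^ 9)"
  proof -
    have "real r = exp (ln (real r))" using r by simp
    also have "\<dots> \<le> exp (Y / 10 ^ 9)" using Y by simp
    finally show ?thesis .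
  qed
  note poly = polynomial_le_exp[OF big(2) kr rY]
  \<comment> \<open>\<open>Y = \<epsilon> k\<close>.  The constants make \<open>c ^ D\<close> much smaller than \<open>M\<close> (few collisions) and \<open>M ^ h\<close> much
    smaller than \<open>exp (h\<^sup>2 / (4 q))\<close> (dense sets of non-edges).\<close>
  define M where "M = nat \<lfloor>exp (Y / 400)\<rfloor>"
  define D where "D = nat \<lceil>Y / 160\<rceil>"
  \<comment> \<open>\<open>k div 4\<close> is used because
    \<open>2 * (k div 4) <= k - h + 1\<close>, which gives the degree condition
    \<open>2 b <= D (k - h + 1)\<close>.\<close>
  define b where "b = D * (k div 4)"
  define h where "h = (k + 1) div 2"
  define q where "q = nat \<lceil>4 * real r / real d\<rceil>"
  define n where "n = nat \<lfloor>exp (real d * Y / 10 ^ 5)\<rfloor>"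
  define c where "c = exp (1 / 10 :: real)"
  define y where "y = exp (Y / 800)"
  have M: "exp (Y / 400) / 2 \<le> real M" "real M \<le> exp (Y / 400)" "1 \<le> M"
    using nat_floor_bounds[of "exp (Y / 400)"] big by (auto simp: M_def)
  have D: "Y / 160 \<le> real D" "real D \<le> Y / 80"
    using nat_ceiling_bounds[of "Y / 160"] big by (auto simp: D_def)
  have k4: "real k / 5 \<le> real (k div 4)" "real (k div 4) \<le> real k / 4" using big kY by - linarith+
  have b: "real k * Y / 800 \<le> real b" "real b \<le> real k * Y / 320"
  proof -
    have "Y / 160 * (real k / 5) \<le> real D * real (k div 4)" using D k4 big by (intro mult_mono) auto
    then show "real k * Y / 800 \<le> real b" by (simp add: b_def mult.commute)
    have "real D * real (k div 4) \<le> Y / 80 * (real k / 4)" using D k4 big by (intro mult_mono) auto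
    then show "real b \<le> real k * Y / 320" by (simp add: b_def mult.commute)
  qed
  have q: "4 * real r / real d \<le> real q" "real q \<le> 8 * real r / real d" "1 \<le> q"
    using nat_ceiling_bounds[of "4 * real r / real d"] r by (auto simp: q_def)
  have q1: "4 * real r \<le> real q * real d" using q(1) r by (simp add: field_simps)
  have q2: "real q * Y \<le> 8 * real k"
  proof -
    have "real q * Y \<le> 8 * real r / real d * Y" using q(2) big by (intro mult_right_mono) auto
    also have "\<dots> = 8 * (Y * real r) / real d" by simp
    also have "\<dots> = 8 * real k" unfolding kd[symmetric] using r by simp
    finally show ?thesis .
  qed
  have n: "real n \<le> exp (real d * Y / 10 ^ 5)" "exp (real d * Y / 10 ^ 5) < real n + 1"
    using nat_floor_bounds[of "exp (real d * Y / 10 ^ 5)"] big by (auto simp: n_def)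
  have "\<exists>\<chi>. set_colouring (s + d) s n \<chi> \<and> \<not> has_mono_clique (s + d) k n \<chi>"
  proof (rule exists_set_colouring_without_mono_clique[where D = D and b = b and h = h and M = M
        and q = q and c = c and y = y])
    show "1 \<le> M" "1 \<le> q" by fact+
    show "1 < c" "1 < y" using big by (auto simp: c_def y_def)
    show "h \<le> k" using kY big by (auto simp: h_def)
    have "2 * (k div 4) \<le> k - h + 1" unfolding h_def by linarith
    then have "D * (2 * (k div 4)) \<le> D * (k - h + 1)" by (rule mult_left_mono) simp
    then show "2 * b \<le> D * (k - h + 1)" by (simp add: b_def mult_ac)
    show "2 * (real M ^ h * 2 ^ b * exp (- real (h choose 2) / (2 * real q))) \<le> 1"
      unfolding h_def by (rule dense_nonedges_bound[OF big(2) kY M(2) b(2) q(3) q2])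
    show "real k ^ 2 * c ^ D \<le> real M"
    proof -
      have "c ^ D = exp (real D / 10)" using exp_of_nat_mult[of D "1 / 10::real"] by (simp add: c_def)
      also have "\<dots> \<le> exp (Y / 800)" using D by simp
      \<comment> \<open>The factor 2 absorbs the rounding in \<open>M\<close>, which is at least
        half of \<open>exp (Y / 400)\<close>.\<close>
      finally have "2 * real k ^ 2 * c ^ D \<le> exp (Y / 800) * exp (Y / 800)"
        using poly(1) by (intro mult_mono) (auto simp: c_def)
      then show ?thesis using M by (simp flip: exp_add)
    qed
    have "real (n choose 2) * ((1 + 2 * y / real M) ^ 2) ^ (s + d) / y ^ (d + 1) \<le> exp (-2)"
      unfolding \<open>r = s + d\<close>[symmetric] y_def
      by (rule noninjective_bound[OF big(2) \<open>1 \<le> d\<close> n(1) M(1) poly(2)])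
    moreover have "real ((n choose k) * ((k choose 2) choose b)) * (2 * exp 1 * (1 + (c - 1) / real q) ^ b) ^ (s + d)
        / c ^ ((d + 1) * b) \<le> exp (-2)"
      unfolding \<open>r = s + d\<close>[symmetric] c_def
      using d assms(4) by (intro missed_bound[OF big(2,1) _ _ kd b(1) n(1) q1]) auto
    moreover have "exp (-2) \<le> (1 / 3 :: real)"
      using exp_ge_add_one_self[of "2::real"] by (simp add: exp_minus field_simps)
    ultimately show "real (n choose 2) * ((1 + 2 * y / real M) ^ 2) ^ (s + d) / y ^ (d + 1)
      + real ((n choose k) * ((k choose 2) choose b)) * (2 * exp 1 * (1 + (c - 1) / real q) ^ b) ^ (s + d)
          / c ^ ((d + 1) * b) < 1"
      by linarith
  qed
  then obtain \<chi> where "set_colouring r s n \<chi>" "\<not> has_mono_clique r k n \<chi>"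
    using \<open>r = s + d\<close> by blast
  then have "n < set_colouring_Ramsey r s k"
    using assms by (intro less_set_colouring_Ramsey) auto
  \<comment> \<open>The strict inequality supplies the \<open>+ 1\<close> that compensates for
    rounding \<open>n\<close> down.\<close>
  then have "real n + 1 \<le> real (set_colouring_Ramsey r s k)" by linarith
  then show ?thesis using n by linarith
qed

theorem theorem1p1:
  shows "\<exists>C \<delta> :: real. C > 0 \<and> \<delta> > 0 \<and>
    (\<forall>(r::nat) (s::nat) (\<epsilon>::real).
       1 \<le> s \<longrightarrow> s < r \<longrightarrow> real s \<le> real r - C * ln (real r) \<longrightarrow>
       \<epsilon> = (real r - real s) / real r \<longrightarrow>
       (\<forall>k::nat. real k \<ge> (C / \<epsilon>) * ln (real r) \<longrightarrow>
          real (set_colouring_Ramsey r s k) \<ge>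
            exp (\<delta> * real k * (real r - real s)\<^sup>2 / real r)))"
proof (intro exI conjI allI impI)
  show "(10 ^ 9 :: real) > 0" "(1 / 10 ^ 5 :: real) > 0" by auto
  fix r s k :: nat and \<epsilon> :: real
  assume s: "1 \<le> s" "s < r" and d: "real s \<le> real r - 10 ^ 9 * ln (real r)"
    and \<epsilon>: "\<epsilon> = (real r - real s) / real r" and k: "real k \<ge> (10 ^ 9 / \<epsilon>) * ln (real r)"
  have rs: "real (r - s) = real r - real s" using s by simp
  have "\<epsilon> > 0" using s \<epsilon> by simp
  \<comment> \<open>The hypothesis on \<open>k\<close> is exactly the lower bound on
    \<open>Y = \<epsilon> k\<close>.\<close>
  then have "10 ^ 9 * ln (real r) \<le> real k * \<epsilon>" using k by (simp add: field_simps)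
  then have "10 ^ 9 * ln (real r) \<le> real k * real (r - s) / real r" by (simp add: \<epsilon> rs)
  then have "exp (real (r - s) * (real k * real (r - s) / real r) / 10 ^ 5) < real (set_colouring_Ramsey r s k)"
    using s d rs by (intro set_colouring_Ramsey_greater) auto
  moreover have "real (r - s) * (real k * real (r - s) / real r) / 10 ^ 5
      = 1 / 10 ^ 5 * real k * (real r - real s)\<^sup>2 / real r"
    unfolding rs power2_eq_square by (simp add: mult_ac)
  ultimately have "exp (1 / 10 ^ 5 * real k * (real r - real s)\<^sup>2 / real r) < real (set_colouring_Ramsey r s k)"
    by (simp only:)
  then show "exp (1 / 10 ^ 5 * real k * (real r - real s)\<^sup>2 / real r) \<le> real (set_colouring_Ramsey r s k)"
    by (rule less_imp_le)
qed

end
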